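(* Let $\mathcal{S}$ be the free sesquicartesian category generated by a set $\mathcal{L}$ of propositional letters, and let $G$ be the functor from $\mathcal{S}$ to the category $\mathcal{G}$ of relations on finite ordinals (both as defined in the context). If $f,g:A\rightarrow B$ are terms of $\mathcal{S}$ and $G(f)=G(g)$ in $\mathcal{G}$, then $f=g$ in $\mathcal{S}$.
   Context: Formulae. Let $\mathcal{L}$ be a set, whose members are called propositional letters. The set $\mathcal{P}_{\times,+,\mathrm{O}}$ of formulae is generated from $\mathcal{L}$ and the constant $\mathrm{O}$ with the binary connectives $\times$ and $+$. Terms of $\mathcal{S}$. Each term has a type $(A,B)$, a pair of formulae of $\mathcal{P}_{\times,+,\mathrm{O}}$; we write $f:A\rightarrow B$. The atomic terms are, for all formulae $A,B$: $\mathbf{1}_A:A\rightarrow A$; $l_A:\mathrm{O}\rightarrow A$; $k^1_{A,B}:A\times B\rightarrow A$; $k^2_{A,B}:A\times B\rightarrow B$; $w_A:A\rightarrow A\times A$; $l^1_{A,B}:A\rightarrow A+B$; $l^2_{A,B}:B\rightarrow A+B$; $m_A:A+A\rightarrow A$. Other terms are generated by: from $f:A\rightarrow B$ and $g:B\rightarrow C$ form $g\circ f:A\rightarrow C$; from $f:A\rightarrow B$ and $g:C\rightarrow D$ form $f\times g:A\times C\rightarrow B\times D$ and $f+g:A+C\rightarrow B+D$. The category $\mathcal{S}$ (free sesquicartesian category generated by $\mathcal{L}$). Its objects are the formulae of $\mathcal{P}_{\times,+,\mathrm{O}}$ and its arrows are equivalence classes of terms under the smallest type-respecting equivalence relation that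 is a congruence for $\circ,\times,+$ and contains all (well-typed) instances of the following equations, for $i\in\{1,2\}$; "$f=g$ in $\mathcal{S}$" means that the terms $f,g$ are equivalent. - $\mathbf{1}_B\circ f=f\circ\mathbf{1}_A=f$ for $f:A\rightarrow B$; $h\circ(g\circ f)=(h\circ g)\circ f$. - $\mathbf{1}_A\times\mathbf{1}_B=\mathbf{1}_{A\times B}$; $(g_1\circ g_2)\times(f_1\circ f_2)=(g_1\times f_1)\circ(g_2\times f_2)$; $k^i_{B_1,B_2}\circ(f_1\times f_2)=f_i\circ k^i_{A_1,A_2}$ for $f_j:A_j\rightarrow B_j$; $w_B\circ f=(f\times f)\circ w_A$ for $f:A\rightarrow B$; $k^i_{A,A}\circ w_A=\mathbf{1}_A$; $(k^1_{A,B}\times k^2_{A,B})\circ w_{A\times B}=\mathbf{1}_{A\times B}$; $k^1_{\mathrm{O},\mathrm{O}}=k^2_{\mathrm{O},\mathrm{O}}$. - $\mathbf{1}_A+\mathbf{1}_B=\mathbf{1}_{A+B}$; $(g_1\circ g_2)+(f_1\circ f_2)=(g_1+f_1)\circ(g_2+f_2)$; $(f_1+f_2)\circ l^i_{A_1,A_2}=l^i_{B_1,B_2}\circ f_i$ for $f_j:A_j\rightarrow B_j$; $f\circ m_A=m_B\circ(f+f)$ for $f:A\rightarrow B$; $m_A\circ l^i_{A,A}=\mathbf{1}_A$; $m_{A+B}\circ(l^1_{A,B}+l^2_{A,B})=\mathbf{1}_{A+B}$; $f=l_A$ for every $f:\mathrm{O}\rightarrow A$. The category $\mathcal{G}$ and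 the functor $G$. The objects of $\mathcal{G}$ are finite ordinals $n=\{0,\dots,n-1\}$; an arrow $n\rightarrow m$ is a binary relation, i.e. a subset of $n\times m$; identities are identity relations and composition is composition of relations. For a formula $A$ let $|A|$ be the number of occurrences of propositional letters in $A$. Put $G(A)=|A|$, and on terms: $G(\mathbf{1}_A)=\{(x,x):x\in|A|\}$; $G(k^1_{A,B})=\{(x,x):x\in|A|\}$; $G(k^2_{A,B})=\{(x+|A|,x):x\in|B|\}$; $G(w_A)=\{(x,x):x\in|A|\}\cup\{(x,x+|A|):x\in|A|\}$; $G(l^1_{A,B})=\{(x,x):x\in|A|\}$; $G(l^2_{A,B})=\{(x,x+|A|):x\in|B|\}$; $G(m_A)=\{(x,x):x\in|A|\}\cup\{(x+|A|,x):x\in|A|\}$; $G(l_A)=\emptyset$; $G(g\circ f)=G(g)\circ G(f)$; and for $f:A\rightarrow B$, $g:C\rightarrow D$, $G(f\times g)=G(f+g)=G(f)\cup\{(x+|A|,y+|B|):(x,y)\in G(g)\}$. This is compatible with equality in $\mathcal{S}$ and gives a functor from $\mathcal{S}$ to $\mathcal{G}$. *)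

theory Defs
  imports Main
begin

section \<open>Formulae\<close>

text \<open>
  The set of propositional letters is an arbitrary, possibly empty, set L over the type
  of letters; a formula over L is one with \<open>letters A \<subseteq> L\<close>.
\<close>

datatype (letters: 'a) formula =
    Letter 'a
  | Zero
  | Prod "'a formula" "'a formula"  (infixr \<open>\<otimes>\<close> 70)
  | Sum "'a formula" "'a formula"  (infixr \<open>\<oplus>\<close> 65)

primrec occs :: "'a formula \<Rightarrow> nat" where
  "occs (Letter p) = 1"
| "occs Zero = 0"
| "occs (A \<otimes> B) = occs A + occs B"
| "occs (A \<oplus> B) = occs A + occs B"


section \<open>Terms\<close>

datatype 'a tm =
    Idt "'a formula"
  | Ini "'a formula"  \<comment> \<open>the term $l_A$\<close>
  | K1 "'a formula" "'a formula"
  | K2 "'a formula" "'a formula"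
  | W "'a formula"
  | L1 "'a formula" "'a formula"
  | L2 "'a formula" "'a formula"
  | M "'a formula"
  | Comp "'a tm" "'a tm"  (infixr \<open>\<bullet>\<close> 60)
  | TProd "'a tm" "'a tm"  (infixr \<open>\<otimes>\<^sub>t\<close> 70)
  | TSum "'a tm" "'a tm"  (infixr \<open>\<oplus>\<^sub>t\<close> 65)

text \<open>The datatype also contains ill-typed compositions; these have no type below.\<close>

inductive has_type :: "'a set \<Rightarrow> 'a tm \<Rightarrow> 'a formula \<Rightarrow> 'a formula \<Rightarrow> bool"
    (\<open>_ \<turnstile> _ \<Colon> _ \<rightarrow> _\<close> [51, 51, 51, 51] 50)
  for L :: "'a set" where
  Idt: "letters A \<subseteq> L \<Longrightarrow> L \<turnstile> Idt A \<Colon> A \<rightarrow> A"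
| Ini: "letters A \<subseteq> L \<Longrightarrow> L \<turnstile> Ini A \<Colon> Zero \<rightarrow> A"
| K1: "letters A \<subseteq> L \<Longrightarrow> letters B \<subseteq> L \<Longrightarrow> L \<turnstile> K1 A B \<Colon> A \<otimes> B \<rightarrow> A"
| K2: "letters A \<subseteq> L \<Longrightarrow> letters B \<subseteq> L \<Longrightarrow> L \<turnstile> K2 A B \<Colon> A \<otimes> B \<rightarrow> B"
| W: "letters A \<subseteq> L \<Longrightarrow> L \<turnstile> W A \<Colon> A \<rightarrow> A \<otimes> A"
| L1: "letters A \<subseteq> L \<Longrightarrow> letters B \<subseteq> L \<Longrightarrow> L \<turnstile> L1 A B \<Colon> A \<rightarrow> A \<oplus> B"
| L2: "letters A \<subseteq> L \<Longrightarrow> letters B \<subseteq> L \<Longrightarrow> L \<turnstile> L2 A B \<Colon> B \<rightarrow> A \<oplus> B"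
| M: "letters A \<subseteq> L \<Longrightarrow> L \<turnstile> M A \<Colon> A \<oplus> A \<rightarrow> A"
| Comp: "L \<turnstile> f \<Colon> A \<rightarrow> B \<Longrightarrow> L \<turnstile> g \<Colon> B \<rightarrow> C \<Longrightarrow> L \<turnstile> g \<bullet> f \<Colon> A \<rightarrow> C"
| TProd: "L \<turnstile> f \<Colon> A \<rightarrow> B \<Longrightarrow> L \<turnstile> g \<Colon> C \<rightarrow> D \<Longrightarrow> L \<turnstile> f \<otimes>\<^sub>t g \<Colon> A \<otimes> C \<rightarrow> B \<otimes> D"
| TSum: "L \<turnstile> f \<Colon> A \<rightarrow> B \<Longrightarrow> L \<turnstile> g \<Colon> C \<rightarrow> D \<Longrightarrow> L \<turnstile> f \<oplus>\<^sub>t g \<Colon> A \<oplus> C \<rightarrow> B \<oplus> D"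

primrec src :: "'a tm \<Rightarrow> 'a formula" where
  "src (Idt A) = A"
| "src (Ini A) = Zero"
| "src (K1 A B) = A \<otimes> B"
| "src (K2 A B) = A \<otimes> B"
| "src (W A) = A"
| "src (L1 A B) = A"
| "src (L2 A B) = B"
| "src (M A) = A \<oplus> A"
| "src (g \<bullet> f) = src f"
| "src (f \<otimes>\<^sub>t g) = src f \<otimes> src g"
| "src (f \<oplus>\<^sub>t g) = src f \<oplus> src g"

primrec tgt :: "'a tm \<Rightarrow> 'a formula" where
  "tgt (Idt A) = A"
| "tgt (Ini A) = A"
| "tgt (K1 A B) = A"
| "tgt (K2 A B) = B"
| "tgt (W A) = A \<otimes> A"
| "tgt (L1 A B) = A \<oplus> B"
| "tgt (L2 A B) = A \<oplus> B"
| "tgt (M A) = A"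
| "tgt (g \<bullet> f) = tgt g"
| "tgt (f \<otimes>\<^sub>t g) = tgt f \<otimes> tgt g"
| "tgt (f \<oplus>\<^sub>t g) = tgt f \<oplus> tgt g"

lemma has_type_unique:
  assumes "L \<turnstile> f \<Colon> A \<rightarrow> B"
  shows "A = src f" and "B = tgt f"
  using assms by (induction rule: has_type.induct) auto

lemma has_type_letters:
  assumes "L \<turnstile> f \<Colon> A \<rightarrow> B"
  shows "letters A \<subseteq> L" and "letters B \<subseteq> L"
  using assms by (induction rule: has_type.induct) auto


section \<open>Equality in the free sesquicartesian category\<close>

inductive S_eq :: "'a set \<Rightarrow> 'a tm \<Rightarrow> 'a tm \<Rightarrow> 'a formula \<Rightarrow> 'a formula \<Rightarrow> bool"
    (\<open>_ \<turnstile> _ \<approx> _ \<Colon> _ \<rightarrow> _\<close> [51, 51, 51, 51, 51] 50)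
  for L :: "'a set" where
  refl: "L \<turnstile> f \<Colon> A \<rightarrow> B \<Longrightarrow> L \<turnstile> f \<approx> f \<Colon> A \<rightarrow> B"
| sym: "L \<turnstile> f \<approx> g \<Colon> A \<rightarrow> B \<Longrightarrow> L \<turnstile> g \<approx> f \<Colon> A \<rightarrow> B"
| trans: "L \<turnstile> f \<approx> g \<Colon> A \<rightarrow> B \<Longrightarrow> L \<turnstile> g \<approx> h \<Colon> A \<rightarrow> B \<Longrightarrow> L \<turnstile> f \<approx> h \<Colon> A \<rightarrow> B"
| cong_Comp: "L \<turnstile> f \<approx> f' \<Colon> A \<rightarrow> B \<Longrightarrow> L \<turnstile> g \<approx> g' \<Colon> B \<rightarrow> C \<Longrightarrow> L \<turnstile> g \<bullet> f \<approx> g' \<bullet> f' \<Colon> A \<rightarrow> C"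
| cong_TProd: "L \<turnstile> f \<approx> f' \<Colon> A \<rightarrow> B \<Longrightarrow> L \<turnstile> g \<approx> g' \<Colon> C \<rightarrow> D
    \<Longrightarrow> L \<turnstile> f \<otimes>\<^sub>t g \<approx> f' \<otimes>\<^sub>t g' \<Colon> A \<otimes> C \<rightarrow> B \<otimes> D"
| cong_TSum: "L \<turnstile> f \<approx> f' \<Colon> A \<rightarrow> B \<Longrightarrow> L \<turnstile> g \<approx> g' \<Colon> C \<rightarrow> D
    \<Longrightarrow> L \<turnstile> f \<oplus>\<^sub>t g \<approx> f' \<oplus>\<^sub>t g' \<Colon> A \<oplus> C \<rightarrow> B \<oplus> D"
| id_left: "L \<turnstile> f \<Colon> A \<rightarrow> B \<Longrightarrow> L \<turnstile> Idt B \<bullet> f \<approx> f \<Colon> A \<rightarrow> B"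
| id_right: "L \<turnstile> f \<Colon> A \<rightarrow> B \<Longrightarrow> L \<turnstile> f \<bullet> Idt A \<approx> f \<Colon> A \<rightarrow> B"
| assoc: "L \<turnstile> f \<Colon> A \<rightarrow> B \<Longrightarrow> L \<turnstile> g \<Colon> B \<rightarrow> C \<Longrightarrow> L \<turnstile> h \<Colon> C \<rightarrow> D
    \<Longrightarrow> L \<turnstile> h \<bullet> (g \<bullet> f) \<approx> (h \<bullet> g) \<bullet> f \<Colon> A \<rightarrow> D"
| prod_id: "letters A \<subseteq> L \<Longrightarrow> letters B \<subseteq> L
    \<Longrightarrow> L \<turnstile> Idt A \<otimes>\<^sub>t Idt B \<approx> Idt (A \<otimes> B) \<Colon> A \<otimes> B \<rightarrow> A \<otimes> B"
| prod_comp: "L \<turnstile> g2 \<Colon> A \<rightarrow> B \<Longrightarrow> L \<turnstile> g1 \<Colon> B \<rightarrow> C \<Longrightarrow> L \<turnstile> f2 \<Colon> A' \<rightarrow> B' \<Longrightarrow> L \<turnstile> f1 \<Colon> B' \<rightarrow> C'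
    \<Longrightarrow> L \<turnstile> (g1 \<bullet> g2) \<otimes>\<^sub>t (f1 \<bullet> f2) \<approx> (g1 \<otimes>\<^sub>t f1) \<bullet> (g2 \<otimes>\<^sub>t f2) \<Colon> A \<otimes> A' \<rightarrow> C \<otimes> C'"
| K1_nat: "L \<turnstile> f1 \<Colon> A1 \<rightarrow> B1 \<Longrightarrow> L \<turnstile> f2 \<Colon> A2 \<rightarrow> B2
    \<Longrightarrow> L \<turnstile> K1 B1 B2 \<bullet> (f1 \<otimes>\<^sub>t f2) \<approx> f1 \<bullet> K1 A1 A2 \<Colon> A1 \<otimes> A2 \<rightarrow> B1"
| K2_nat: "L \<turnstile> f1 \<Colon> A1 \<rightarrow> B1 \<Longrightarrow> L \<turnstile> f2 \<Colon> A2 \<rightarrow> B2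
    \<Longrightarrow> L \<turnstile> K2 B1 B2 \<bullet> (f1 \<otimes>\<^sub>t f2) \<approx> f2 \<bullet> K2 A1 A2 \<Colon> A1 \<otimes> A2 \<rightarrow> B2"
| W_nat: "L \<turnstile> f \<Colon> A \<rightarrow> B \<Longrightarrow> L \<turnstile> W B \<bullet> f \<approx> (f \<otimes>\<^sub>t f) \<bullet> W A \<Colon> A \<rightarrow> B \<otimes> B"
| K1_W: "letters A \<subseteq> L \<Longrightarrow> L \<turnstile> K1 A A \<bullet> W A \<approx> Idt A \<Colon> A \<rightarrow> A"
| K2_W: "letters A \<subseteq> L \<Longrightarrow> L \<turnstile> K2 A A \<bullet> W A \<approx> Idt A \<Colon> A \<rightarrow> A"
| K_W: "letters A \<subseteq> L \<Longrightarrow> letters B \<subseteq> L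
    \<Longrightarrow> L \<turnstile> (K1 A B \<otimes>\<^sub>t K2 A B) \<bullet> W (A \<otimes> B) \<approx> Idt (A \<otimes> B) \<Colon> A \<otimes> B \<rightarrow> A \<otimes> B"
| K_Zero: "L \<turnstile> K1 Zero Zero \<approx> K2 Zero Zero \<Colon> Zero \<otimes> Zero \<rightarrow> Zero"
| sum_id: "letters A \<subseteq> L \<Longrightarrow> letters B \<subseteq> L
    \<Longrightarrow> L \<turnstile> Idt A \<oplus>\<^sub>t Idt B \<approx> Idt (A \<oplus> B) \<Colon> A \<oplus> B \<rightarrow> A \<oplus> B"
| sum_comp: "L \<turnstile> g2 \<Colon> A \<rightarrow> B \<Longrightarrow> L \<turnstile> g1 \<Colon> B \<rightarrow> C \<Longrightarrow> L \<turnstile> f2 \<Colon> A' \<rightarrow> B' \<Longrightarrow> L \<turnstile> f1 \<Colon> B' \<rightarrow> C'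
    \<Longrightarrow> L \<turnstile> (g1 \<bullet> g2) \<oplus>\<^sub>t (f1 \<bullet> f2) \<approx> (g1 \<oplus>\<^sub>t f1) \<bullet> (g2 \<oplus>\<^sub>t f2) \<Colon> A \<oplus> A' \<rightarrow> C \<oplus> C'"
| L1_nat: "L \<turnstile> f1 \<Colon> A1 \<rightarrow> B1 \<Longrightarrow> L \<turnstile> f2 \<Colon> A2 \<rightarrow> B2
    \<Longrightarrow> L \<turnstile> (f1 \<oplus>\<^sub>t f2) \<bullet> L1 A1 A2 \<approx> L1 B1 B2 \<bullet> f1 \<Colon> A1 \<rightarrow> B1 \<oplus> B2"
| L2_nat: "L \<turnstile> f1 \<Colon> A1 \<rightarrow> B1 \<Longrightarrow> L \<turnstile> f2 \<Colon> A2 \<rightarrow> B2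
    \<Longrightarrow> L \<turnstile> (f1 \<oplus>\<^sub>t f2) \<bullet> L2 A1 A2 \<approx> L2 B1 B2 \<bullet> f2 \<Colon> A2 \<rightarrow> B1 \<oplus> B2"
| M_nat: "L \<turnstile> f \<Colon> A \<rightarrow> B \<Longrightarrow> L \<turnstile> f \<bullet> M A \<approx> M B \<bullet> (f \<oplus>\<^sub>t f) \<Colon> A \<oplus> A \<rightarrow> B"
| M_L1: "letters A \<subseteq> L \<Longrightarrow> L \<turnstile> M A \<bullet> L1 A A \<approx> Idt A \<Colon> A \<rightarrow> A"
| M_L2: "letters A \<subseteq> L \<Longrightarrow> L \<turnstile> M A \<bullet> L2 A A \<approx> Idt A \<Colon> A \<rightarrow> A"
| M_L: "letters A \<subseteq> L \<Longrightarrow> letters B \<subseteq> L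
    \<Longrightarrow> L \<turnstile> M (A \<oplus> B) \<bullet> (L1 A B \<oplus>\<^sub>t L2 A B) \<approx> Idt (A \<oplus> B) \<Colon> A \<oplus> B \<rightarrow> A \<oplus> B"
| Ini_unique: "L \<turnstile> f \<Colon> Zero \<rightarrow> A \<Longrightarrow> L \<turnstile> f \<approx> Ini A \<Colon> Zero \<rightarrow> A"

lemma S_eq_has_type:
  assumes "L \<turnstile> f \<approx> g \<Colon> A \<rightarrow> B"
  shows "L \<turnstile> f \<Colon> A \<rightarrow> B" and "L \<turnstile> g \<Colon> A \<rightarrow> B"
  using assms
  by (induction rule: S_eq.induct)
    (auto intro!: has_type.intros dest: has_type_letters)


section \<open>The functor to relations on finite ordinals\<close>

text \<open>
  An arrow from n to m is a relation included in \<open>{..<n} \<times> {..<m}\<close>. As \<open>O\<close>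
  composes relations in diagrammatic order, the value at \<open>g \<bullet> f\<close> is \<open>G f O G g\<close>.
\<close>

primrec G :: "'a tm \<Rightarrow> (nat \<times> nat) set" where
  "G (Idt A) = {(x, x) | x. x < occs A}"
| "G (Ini A) = {}"
| "G (K1 A B) = {(x, x) | x. x < occs A}"
| "G (K2 A B) = {(x + occs A, x) | x. x < occs B}"
| "G (W A) = {(x, x) | x. x < occs A} \<union> {(x, x + occs A) | x. x < occs A}"
| "G (L1 A B) = {(x, x) | x. x < occs A}"
| "G (L2 A B) = {(x, x + occs A) | x. x < occs B}"
| "G (M A) = {(x, x) | x. x < occs A} \<union> {(x + occs A, x) | x. x < occs A}"
| "G (g \<bullet> f) = G f O G g"
| "G (f \<otimes>\<^sub>t g) = G f \<union> {(x + occs (src f), y + occs (tgt f)) | x y. (x, y) \<in> G g}"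
| "G (f \<oplus>\<^sub>t g) = G f \<union> {(x + occs (src f), y + occs (tgt f)) | x y. (x, y) \<in> G g}"

end

theory Submission
  imports Defs
begin

text \<open>
  Every term equals a cut-free one, so arrows can be compared by induction on their source
  and target. A sum in the source or a product in the target is split by its universal
  property. Since O is subterminal (the two projections of \<open>O \<times> O\<close> agree), arrows into O,
  and hence arrows with empty relation, which all factor through O, are unique. In the
  remaining case each of the two arrows starts with a projection or ends with an injection.
  An injection in one of them can be extracted from the other as well, and two arrows
  starting with different projections have disjoint relations.
\<close>

section \<open>Universal properties\<close>

text \<open>Composition is the obstacle: the middle formula of a composite may be larger than source
  and target, and pairs may get lost in it, so the relation says little about the two factors.
  Cut-free forms remove the middle formula. They are not unique, and no normal form is computed;
  only the last rule is inspected, and the relation decides which rule can be chosen for both arrows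
  at once. The constant O breaks the duality of products and sums. It is initial but only
  subterminal: dropping a factor A2 from A1 x A2 may be impossible although the relation does not
  touch A2, since there may be no arrow from A1 to A2. Hence the order of the final case analysis:
  an injection at the end of either arrow is used first, and projections are compared only when
  neither arrow offers one. The equation between the two projections of O x O is forced by the
  theorem, as both have the empty relation. The same example shows why the empty relation is settled
  beforehand: there, different projections may give equal arrows.\<close>

declare S_eq.trans [trans]

lemma S_eq_typed:
  assumes "L \<turnstile> f \<approx> g \<Colon> A \<rightarrow> B"
  shows "L \<turnstile> f \<Colon> A \<rightarrow> B" "L \<turnstile> g \<Colon> A \<rightarrow> B" "letters A \<subseteq> L" "letters B \<subseteq> L"
  using S_eq_has_type[OF assms] has_type_letters by blast+

text \<open>The constants \<open>W\<close> and \<open>M\<close> carry a formula that the two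
  components do not supply explicitly, so it is computed by \<open>src\<close> or
  \<open>tgt\<close>. On typed terms it is the expected one, and \<open>pair_eq\<close> and
  \<open>copair_eq\<close> are the forms used later.\<close>

definition pair :: "'a tm \<Rightarrow> 'a tm \<Rightarrow> 'a tm" where
  "pair f g = (f \<otimes>\<^sub>t g) \<bullet> W (src f)"

definition copair :: "'a tm \<Rightarrow> 'a tm \<Rightarrow> 'a tm" where
  "copair f g = M (tgt f) \<bullet> (f \<oplus>\<^sub>t g)"

lemma pair_eq: "L \<turnstile> f \<Colon> A \<rightarrow> B \<Longrightarrow> pair f g = (f \<otimes>\<^sub>t g) \<bullet> W A"
  by (simp add: pair_def has_type_unique(1)[symmetric])

lemma copair_eq: "L \<turnstile> f \<Colon> A \<rightarrow> C \<Longrightarrow> copair f g = M C \<bullet> (f \<oplus>\<^sub>t g)"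
  by (simp add: copair_def has_type_unique(2)[symmetric])

lemma pair_type: "L \<turnstile> f \<Colon> A \<rightarrow> B \<Longrightarrow> L \<turnstile> g \<Colon> A \<rightarrow> C \<Longrightarrow> L \<turnstile> pair f g \<Colon> A \<rightarrow> B \<otimes> C"
  by (simp add: pair_eq) (blast intro: has_type.intros dest: has_type_letters)

lemma copair_type: "L \<turnstile> f \<Colon> A \<rightarrow> C \<Longrightarrow> L \<turnstile> g \<Colon> B \<rightarrow> C \<Longrightarrow> L \<turnstile> copair f g \<Colon> A \<oplus> B \<rightarrow> C"
  by (simp add: copair_eq) (blast intro: has_type.intros dest: has_type_letters)

lemmas typing = has_type.intros pair_type copair_type

lemma comp_cong_left:
  "L \<turnstile> g \<approx> g' \<Colon> B \<rightarrow> C \<Longrightarrow> L \<turnstile> f \<Colon> A \<rightarrow> B \<Longrightarrow> L \<turnstile> g \<bullet> f \<approx> g' \<bullet> f \<Colon> A \<rightarrow> C"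
  by (blast intro: S_eq.intros)

lemma comp_cong_right:
  "L \<turnstile> f \<approx> f' \<Colon> A \<rightarrow> B \<Longrightarrow> L \<turnstile> g \<Colon> B \<rightarrow> C \<Longrightarrow> L \<turnstile> g \<bullet> f \<approx> g \<bullet> f' \<Colon> A \<rightarrow> C"
  by (blast intro: S_eq.intros)

lemma assoc':
  "L \<turnstile> f \<Colon> A \<rightarrow> B \<Longrightarrow> L \<turnstile> g \<Colon> B \<rightarrow> C \<Longrightarrow> L \<turnstile> h \<Colon> C \<rightarrow> D
    \<Longrightarrow> L \<turnstile> (h \<bullet> g) \<bullet> f \<approx> h \<bullet> (g \<bullet> f) \<Colon> A \<rightarrow> D"
  by (blast intro: S_eq.intros)

lemma pair_cong:
  assumes "L \<turnstile> f \<approx> f' \<Colon> A \<rightarrow> B" "L \<turnstile> g \<approx> g' \<Colon> A \<rightarrow> C"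
  shows "L \<turnstile> pair f g \<approx> pair f' g' \<Colon> A \<rightarrow> B \<otimes> C"
proof -
  note t = S_eq_typed[OF assms(1)]
  have "L \<turnstile> (f \<otimes>\<^sub>t g) \<bullet> W A \<approx> (f' \<otimes>\<^sub>t g') \<bullet> W A \<Colon> A \<rightarrow> B \<otimes> C"
    by (rule comp_cong_left cong_TProd has_type.W assms t)+
  then show ?thesis by (simp add: pair_eq[OF t(1)] pair_eq[OF t(2)])
qed

lemma copair_cong:
  assumes "L \<turnstile> f \<approx> f' \<Colon> A \<rightarrow> C" "L \<turnstile> g \<approx> g' \<Colon> B \<rightarrow> C"
  shows "L \<turnstile> copair f g \<approx> copair f' g' \<Colon> A \<oplus> B \<rightarrow> C"
proof -
  note t = S_eq_typed[OF assms(1)]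
  have "L \<turnstile> M C \<bullet> (f \<oplus>\<^sub>t g) \<approx> M C \<bullet> (f' \<oplus>\<^sub>t g') \<Colon> A \<oplus> B \<rightarrow> C"
    by (rule comp_cong_right cong_TSum has_type.M assms t)+
  then show ?thesis by (simp add: copair_eq[OF t(1)] copair_eq[OF t(2)])
qed

section \<open>Computation, fusion and extensionality laws of pairing and copairing\<close>

lemma K1_pair:
  assumes f: "L \<turnstile> f \<Colon> A \<rightarrow> B" and g: "L \<turnstile> g \<Colon> A \<rightarrow> C"
  shows "L \<turnstile> K1 B C \<bullet> pair f g \<approx> f \<Colon> A \<rightarrow> B"
proof -
  note l = has_type_letters[OF f] has_type_letters[OF g]
  have "L \<turnstile> K1 B C \<bullet> ((f \<otimes>\<^sub>t g) \<bullet> W A) \<approx> (K1 B C \<bullet> (f \<otimes>\<^sub>t g)) \<bullet> W A \<Colon> A \<rightarrow> B" (is "S_eq _ _ ?t _ _")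
    by (rule S_eq.assoc typing l f g)+
  also have "L \<turnstile> ?t \<approx> (f \<bullet> K1 A A) \<bullet> W A \<Colon> A \<rightarrow> B" (is "S_eq _ _ ?t _ _")
    by (rule comp_cong_left K1_nat typing l f g)+
  also have "L \<turnstile> ?t \<approx> f \<bullet> (K1 A A \<bullet> W A) \<Colon> A \<rightarrow> B" (is "S_eq _ _ ?t _ _")
    by (rule assoc' typing l f g)+
  also have "L \<turnstile> ?t \<approx> f \<bullet> Idt A \<Colon> A \<rightarrow> B" (is "S_eq _ _ ?t _ _")
    by (rule comp_cong_right K1_W l f)+
  also have "L \<turnstile> ?t \<approx> f \<Colon> A \<rightarrow> B"
    by (rule id_right f)+
  finally show ?thesis by (simp add: pair_eq[OF f])
qed

lemma K2_pair:
  assumes f: "L \<turnstile> f \<Colon> A \<rightarrow> B" and g: "L \<turnstile> g \<Colon> A \<rightarrow> C"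
  shows "L \<turnstile> K2 B C \<bullet> pair f g \<approx> g \<Colon> A \<rightarrow> C"
proof -
  note l = has_type_letters[OF f] has_type_letters[OF g]
  have "L \<turnstile> K2 B C \<bullet> ((f \<otimes>\<^sub>t g) \<bullet> W A) \<approx> (K2 B C \<bullet> (f \<otimes>\<^sub>t g)) \<bullet> W A \<Colon> A \<rightarrow> C" (is "S_eq _ _ ?t _ _")
    by (rule S_eq.assoc typing l f g)+
  also have "L \<turnstile> ?t \<approx> (g \<bullet> K2 A A) \<bullet> W A \<Colon> A \<rightarrow> C" (is "S_eq _ _ ?t _ _")
    by (rule comp_cong_left K2_nat typing l f g)+
  also have "L \<turnstile> ?t \<approx> g \<bullet> (K2 A A \<bullet> W A) \<Colon> A \<rightarrow> C" (is "S_eq _ _ ?t _ _")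
    by (rule assoc' typing l f g)+
  also have "L \<turnstile> ?t \<approx> g \<bullet> Idt A \<Colon> A \<rightarrow> C" (is "S_eq _ _ ?t _ _")
    by (rule comp_cong_right K2_W l g)+
  also have "L \<turnstile> ?t \<approx> g \<Colon> A \<rightarrow> C"
    by (rule id_right g)+
  finally show ?thesis by (simp add: pair_eq[OF f])
qed

lemma copair_L1:
  assumes f: "L \<turnstile> f \<Colon> A \<rightarrow> C" and g: "L \<turnstile> g \<Colon> B \<rightarrow> C"
  shows "L \<turnstile> copair f g \<bullet> L1 A B \<approx> f \<Colon> A \<rightarrow> C"
proof -
  note l = has_type_letters[OF f] has_type_letters[OF g]
  have "L \<turnstile> (M C \<bullet> (f \<oplus>\<^sub>t g)) \<bullet> L1 A B \<approx> M C \<bullet> ((f \<oplus>\<^sub>t g) \<bullet> L1 A B) \<Colon> A \<rightarrow> C" (is "S_eq _ _ ?t _ _")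
    by (rule assoc' typing l f g)+
  also have "L \<turnstile> ?t \<approx> M C \<bullet> (L1 C C \<bullet> f) \<Colon> A \<rightarrow> C" (is "S_eq _ _ ?t _ _")
    by (rule comp_cong_right L1_nat typing l f g)+
  also have "L \<turnstile> ?t \<approx> (M C \<bullet> L1 C C) \<bullet> f \<Colon> A \<rightarrow> C" (is "S_eq _ _ ?t _ _")
    by (rule S_eq.assoc typing l f g)+
  also have "L \<turnstile> ?t \<approx> Idt C \<bullet> f \<Colon> A \<rightarrow> C" (is "S_eq _ _ ?t _ _")
    by (rule comp_cong_left M_L1 l f)+
  also have "L \<turnstile> ?t \<approx> f \<Colon> A \<rightarrow> C"
    by (rule id_left f)+
  finally show ?thesis by (simp add: copair_eq[OF f])
qed

lemma copair_L2:
  assumes f: "L \<turnstile> f \<Colon> A \<rightarrow> C" and g: "L \<turnstile> g \<Colon> B \<rightarrow> C"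
  shows "L \<turnstile> copair f g \<bullet> L2 A B \<approx> g \<Colon> B \<rightarrow> C"
proof -
  note l = has_type_letters[OF f] has_type_letters[OF g]
  have "L \<turnstile> (M C \<bullet> (f \<oplus>\<^sub>t g)) \<bullet> L2 A B \<approx> M C \<bullet> ((f \<oplus>\<^sub>t g) \<bullet> L2 A B) \<Colon> B \<rightarrow> C" (is "S_eq _ _ ?t _ _")
    by (rule assoc' typing l f g)+
  also have "L \<turnstile> ?t \<approx> M C \<bullet> (L2 C C \<bullet> g) \<Colon> B \<rightarrow> C" (is "S_eq _ _ ?t _ _")
    by (rule comp_cong_right L2_nat typing l f g)+
  also have "L \<turnstile> ?t \<approx> (M C \<bullet> L2 C C) \<bullet> g \<Colon> B \<rightarrow> C" (is "S_eq _ _ ?t _ _")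
    by (rule S_eq.assoc typing l f g)+
  also have "L \<turnstile> ?t \<approx> Idt C \<bullet> g \<Colon> B \<rightarrow> C" (is "S_eq _ _ ?t _ _")
    by (rule comp_cong_left M_L2 l g)+
  also have "L \<turnstile> ?t \<approx> g \<Colon> B \<rightarrow> C"
    by (rule id_left g)+
  finally show ?thesis by (simp add: copair_eq[OF f])
qed

lemma pair_comp:
  assumes f: "L \<turnstile> f \<Colon> A \<rightarrow> B" and g: "L \<turnstile> g \<Colon> A \<rightarrow> C" and h: "L \<turnstile> h \<Colon> D \<rightarrow> A"
  shows "L \<turnstile> pair f g \<bullet> h \<approx> pair (f \<bullet> h) (g \<bullet> h) \<Colon> D \<rightarrow> B \<otimes> C"
proof -
  note l = has_type_letters[OF f] has_type_letters[OF g] has_type_letters[OF h]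
  have fh: "L \<turnstile> f \<bullet> h \<Colon> D \<rightarrow> B" by (rule typing f h)+
  have "L \<turnstile> ((f \<otimes>\<^sub>t g) \<bullet> W A) \<bullet> h \<approx> (f \<otimes>\<^sub>t g) \<bullet> (W A \<bullet> h) \<Colon> D \<rightarrow> B \<otimes> C" (is "S_eq _ _ ?t _ _")
    by (rule assoc' typing l f g h)+
  also have "L \<turnstile> ?t \<approx> (f \<otimes>\<^sub>t g) \<bullet> ((h \<otimes>\<^sub>t h) \<bullet> W D) \<Colon> D \<rightarrow> B \<otimes> C" (is "S_eq _ _ ?t _ _")
    by (rule comp_cong_right W_nat typing l f g h)+
  also have "L \<turnstile> ?t \<approx> ((f \<otimes>\<^sub>t g) \<bullet> (h \<otimes>\<^sub>t h)) \<bullet> W D \<Colon> D \<rightarrow> B \<otimes> C" (is "S_eq _ _ ?t _ _")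
    by (rule S_eq.assoc typing l f g h)+
  also have "L \<turnstile> ?t \<approx> ((f \<bullet> h) \<otimes>\<^sub>t (g \<bullet> h)) \<bullet> W D \<Colon> D \<rightarrow> B \<otimes> C"
    by (rule comp_cong_left S_eq.sym[OF prod_comp] typing l f g h)+
  finally show ?thesis by (simp add: pair_eq[OF f] pair_eq[OF fh])
qed

lemma comp_copair:
  assumes f: "L \<turnstile> f \<Colon> A \<rightarrow> C" and g: "L \<turnstile> g \<Colon> B \<rightarrow> C" and h: "L \<turnstile> h \<Colon> C \<rightarrow> D"
  shows "L \<turnstile> h \<bullet> copair f g \<approx> copair (h \<bullet> f) (h \<bullet> g) \<Colon> A \<oplus> B \<rightarrow> D"
proof -
  note l = has_type_letters[OF f] has_type_letters[OF g] has_type_letters[OF h]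
  have hf: "L \<turnstile> h \<bullet> f \<Colon> A \<rightarrow> D" by (rule typing f h)+
  have "L \<turnstile> h \<bullet> (M C \<bullet> (f \<oplus>\<^sub>t g)) \<approx> (h \<bullet> M C) \<bullet> (f \<oplus>\<^sub>t g) \<Colon> A \<oplus> B \<rightarrow> D" (is "S_eq _ _ ?t _ _")
    by (rule S_eq.assoc typing l f g h)+
  also have "L \<turnstile> ?t \<approx> (M D \<bullet> (h \<oplus>\<^sub>t h)) \<bullet> (f \<oplus>\<^sub>t g) \<Colon> A \<oplus> B \<rightarrow> D" (is "S_eq _ _ ?t _ _")
    by (rule comp_cong_left M_nat typing l f g h)+
  also have "L \<turnstile> ?t \<approx> M D \<bullet> ((h \<oplus>\<^sub>t h) \<bullet> (f \<oplus>\<^sub>t g)) \<Colon> A \<oplus> B \<rightarrow> D" (is "S_eq _ _ ?t _ _")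
    by (rule assoc' typing l f g h)+
  also have "L \<turnstile> ?t \<approx> M D \<bullet> ((h \<bullet> f) \<oplus>\<^sub>t (h \<bullet> g)) \<Colon> A \<oplus> B \<rightarrow> D"
    by (rule comp_cong_right S_eq.sym[OF sum_comp] typing l f g h)+
  finally show ?thesis by (simp add: copair_eq[OF f] copair_eq[OF hf])
qed

lemma pair_eta:
  assumes f: "L \<turnstile> f \<Colon> A \<rightarrow> B \<otimes> C"
  shows "L \<turnstile> pair (K1 B C \<bullet> f) (K2 B C \<bullet> f) \<approx> f \<Colon> A \<rightarrow> B \<otimes> C"
proof -
  have l: "letters B \<subseteq> L" "letters C \<subseteq> L" using has_type_letters[OF f] by auto
  have k: "L \<turnstile> K1 B C \<Colon> B \<otimes> C \<rightarrow> B" "L \<turnstile> K2 B C \<Colon> B \<otimes> C \<rightarrow> C"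
    by (rule typing l)+
  have "L \<turnstile> pair (K1 B C \<bullet> f) (K2 B C \<bullet> f) \<approx> pair (K1 B C) (K2 B C) \<bullet> f \<Colon> A \<rightarrow> B \<otimes> C" (is "S_eq _ _ ?t _ _")
    by (rule S_eq.sym[OF pair_comp] k f)+
  also have "L \<turnstile> ?t \<approx> Idt (B \<otimes> C) \<bullet> f \<Colon> A \<rightarrow> B \<otimes> C" (is "S_eq _ _ ?t _ _")
    \<comment> \<open>Unfolded, the pairing of the two projections is literally the left side of the
      equation \<open>K_W\<close>.\<close>
    unfolding pair_eq[OF k(1)] by (rule comp_cong_left K_W l f)+
  also have "L \<turnstile> ?t \<approx> f \<Colon> A \<rightarrow> B \<otimes> C"
    by (rule id_left f)+
  finally show ?thesis .
qed

lemma copair_eta: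
  assumes f: "L \<turnstile> f \<Colon> A \<oplus> B \<rightarrow> C"
  shows "L \<turnstile> copair (f \<bullet> L1 A B) (f \<bullet> L2 A B) \<approx> f \<Colon> A \<oplus> B \<rightarrow> C"
proof -
  have l: "letters A \<subseteq> L" "letters B \<subseteq> L" using has_type_letters[OF f] by auto
  have k: "L \<turnstile> L1 A B \<Colon> A \<rightarrow> A \<oplus> B" "L \<turnstile> L2 A B \<Colon> B \<rightarrow> A \<oplus> B"
    by (rule typing l)+
  have "L \<turnstile> copair (f \<bullet> L1 A B) (f \<bullet> L2 A B) \<approx> f \<bullet> copair (L1 A B) (L2 A B) \<Colon> A \<oplus> B \<rightarrow> C" (is "S_eq _ _ ?t _ _")
    by (rule S_eq.sym[OF comp_copair] k f)+
  also have "L \<turnstile> ?t \<approx> f \<bullet> Idt (A \<oplus> B) \<Colon> A \<oplus> B \<rightarrow> C" (is "S_eq _ _ ?t _ _")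
    unfolding copair_eq[OF k(1)] by (rule comp_cong_right M_L l f)+
  also have "L \<turnstile> ?t \<approx> f \<Colon> A \<oplus> B \<rightarrow> C"
    by (rule id_right f)+
  finally show ?thesis .
qed

text \<open>Both arrows are rebuilt from their components by \<open>pair_eta\<close>. In the main
  induction this replaces a product target by its factors; \<open>sum_ext\<close> does the same for
  a sum source.\<close>

lemma prod_ext:
  assumes f: "L \<turnstile> f \<Colon> A \<rightarrow> B \<otimes> C" and g: "L \<turnstile> g \<Colon> A \<rightarrow> B \<otimes> C"
    and 1: "L \<turnstile> K1 B C \<bullet> f \<approx> K1 B C \<bullet> g \<Colon> A \<rightarrow> B"
    and 2: "L \<turnstile> K2 B C \<bullet> f \<approx> K2 B C \<bullet> g \<Colon> A \<rightarrow> C"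
  shows "L \<turnstile> f \<approx> g \<Colon> A \<rightarrow> B \<otimes> C"
  using pair_eta[OF f] pair_eta[OF g] pair_cong[OF 1 2] S_eq.sym S_eq.trans by metis

lemma sum_ext:
  assumes f: "L \<turnstile> f \<Colon> A \<oplus> B \<rightarrow> C" and g: "L \<turnstile> g \<Colon> A \<oplus> B \<rightarrow> C"
    and 1: "L \<turnstile> f \<bullet> L1 A B \<approx> g \<bullet> L1 A B \<Colon> A \<rightarrow> C"
    and 2: "L \<turnstile> f \<bullet> L2 A B \<approx> g \<bullet> L2 A B \<Colon> B \<rightarrow> C"
  shows "L \<turnstile> f \<approx> g \<Colon> A \<oplus> B \<rightarrow> C"
  using copair_eta[OF f] copair_eta[OF g] copair_cong[OF 1 2] S_eq.sym S_eq.trans by metis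

text \<open>Any two arrows into O are the two projections of a single arrow, their pairing, and the
  projections of O x O are equal.\<close>

lemma Zero_subterminal:
  assumes f: "L \<turnstile> f \<Colon> A \<rightarrow> Zero" and g: "L \<turnstile> g \<Colon> A \<rightarrow> Zero"
  shows "L \<turnstile> f \<approx> g \<Colon> A \<rightarrow> Zero"
proof -
  have "L \<turnstile> f \<approx> K1 Zero Zero \<bullet> pair f g \<Colon> A \<rightarrow> Zero" (is "S_eq _ _ ?t _ _")
    by (rule S_eq.sym[OF K1_pair[OF f g]])
  also have "L \<turnstile> ?t \<approx> K2 Zero Zero \<bullet> pair f g \<Colon> A \<rightarrow> Zero" (is "S_eq _ _ ?t _ _")
    by (rule comp_cong_left K_Zero pair_type f g)+
  also have "L \<turnstile> ?t \<approx> g \<Colon> A \<rightarrow> Zero"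
    by (rule K2_pair[OF f g])
  finally show ?thesis .
qed


section \<open>Soundness of the functor\<close>

text \<open>In the defining clause the offsets come from \<open>src\<close> and \<open>tgt\<close>.
  With a typing at hand they become the sizes of the given formulae, and later simplifications use
  this form in place of the raw clause.\<close>

lemma G_TProd: "L \<turnstile> f \<Colon> A \<rightarrow> B \<Longrightarrow>
    G (f \<otimes>\<^sub>t g) = G f \<union> {(x + occs A, y + occs B) | x y. (x, y) \<in> G g}"
  by (auto dest: has_type_unique)

lemma G_TSum: "L \<turnstile> f \<Colon> A \<rightarrow> B \<Longrightarrow>
    G (f \<oplus>\<^sub>t g) = G f \<union> {(x + occs A, y + occs B) | x y. (x, y) \<in> G g}"
  by (auto dest: has_type_unique)

text \<open>The bounds keep the two blocks of a product or sum apart: they feed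
  \<open>block_relcomp\<close>, and later they separate arrows that start with different
  projections.\<close>

lemma G_bound:
  assumes "L \<turnstile> f \<Colon> A \<rightarrow> B"
  shows "G f \<subseteq> {..<occs A} \<times> {..<occs B}"
  using assms
proof (induction rule: has_type.induct)
  case (TProd f A B g C D)
  then show ?case unfolding G_TProd[OF TProd(1)] by auto
next
  case (TSum f A B g C D)
  then show ?case unfolding G_TSum[OF TSum(1)] by auto
next
  case (Comp f A B g C)
  then show ?case by auto
qed auto

lemma G_boundD:
  assumes "L \<turnstile> f \<Colon> A \<rightarrow> B" "(x, y) \<in> G f"
  shows "x < occs A" "y < occs B"
  using G_bound assms by blast+

lemma diag_add:
  "{(x, x) | x. x < m + n} = {(x, x) | x. x < m} \<union> {(x + m, x + m) | x. x < (n::nat)}"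
proof -
  have "x < m \<or> (\<exists>z. x = z + m \<and> z < n)" if "x < m + n" for x
    using that by presburger
  then show ?thesis by fastforce
qed

text \<open>The mixed composites vanish: \<open>R\<close> ends below \<open>n\<close> where the
  shifted \<open>S'\<close> has no source, and the shifted \<open>R'\<close> ends at or above
  \<open>n\<close> where \<open>S\<close> has none.\<close>

lemma block_relcomp:
  assumes "R \<subseteq> UNIV \<times> {..<n}" "S \<subseteq> {..<n::nat} \<times> UNIV"
  shows "(R \<union> {(x + m :: nat, y + n) | x y. (x, y) \<in> R'}) O (S \<union> {(x + n, y + k :: nat) | x y. (x, y) \<in> S'})
    = R O S \<union> {(x + m, y + k) | x y. (x, y) \<in> R' O S'}"
proof -
  have "R O {(x + n, y + k) | x y. (x, y) \<in> S'} = {}"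
    using assms(1) by fastforce
  moreover have "{(x + m, y + n) | x y. (x, y) \<in> R'} O S = {}"
    using assms(2) by fastforce
  moreover have "{(x + m, y + n) | x y. (x, y) \<in> R'} O {(x + n, y + k) | x y. (x, y) \<in> S'}
      = {(x + m, y + k) | x y. (x, y) \<in> R' O S'}"
    by (auto simp: relcomp_unfold)
  ultimately show ?thesis by (simp add: relcomp_distrib relcomp_distrib2)
qed

text \<open>Needed because cut-free forms and factorizations are obtained only up to equality; their
  relations must be those of the original arrows.\<close>

lemma G_sound:
  assumes "L \<turnstile> f \<approx> g \<Colon> A \<rightarrow> B"
  shows "G f = G g"
  using assms
proof (induction rule: S_eq.induct)
  case (cong_TProd f f' A B g g' C D)
  then show ?case
    using S_eq_typed(1,2)[OF cong_TProd(1)] by (simp add: G_TProd del: G.simps)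
next
  case (cong_TSum f f' A B g g' C D)
  then show ?case
    using S_eq_typed(1,2)[OF cong_TSum(1)] by (simp add: G_TSum del: G.simps)
next
  case (id_left f A B)
  then show ?case by (auto dest: G_boundD)
next
  case (id_right f A B)
  then show ?case by (auto dest: G_boundD)
next
  case (prod_id A B)
  show ?case using diag_add[of "occs A" "occs B"] by auto
next
  case (sum_id A B)
  show ?case using diag_add[of "occs A" "occs B"] by auto
next
  case (prod_comp g2 A B g1 C f2 A' B' f1 C')
  have "G ((g1 \<otimes>\<^sub>t f1) \<bullet> (g2 \<otimes>\<^sub>t f2)) = G (g1 \<bullet> g2) \<union>
      {(x + occs A, y + occs C) | x y. (x, y) \<in> G (f1 \<bullet> f2)}"
    unfolding G.simps(9) G_TProd[OF prod_comp(1)] G_TProd[OF prod_comp(2)]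
    using G_bound[OF prod_comp(1)] G_bound[OF prod_comp(2)] by (intro block_relcomp) auto
  then show ?case unfolding G_TProd[OF has_type.Comp[OF prod_comp(1,2)]] by simp
next
  case (sum_comp g2 A B g1 C f2 A' B' f1 C')
  have "G ((g1 \<oplus>\<^sub>t f1) \<bullet> (g2 \<oplus>\<^sub>t f2)) = G (g1 \<bullet> g2) \<union>
      {(x + occs A, y + occs C) | x y. (x, y) \<in> G (f1 \<bullet> f2)}"
    unfolding G.simps(9) G_TSum[OF sum_comp(1)] G_TSum[OF sum_comp(2)]
    using G_bound[OF sum_comp(1)] G_bound[OF sum_comp(2)] by (intro block_relcomp) auto
  then show ?case unfolding G_TSum[OF has_type.Comp[OF sum_comp(1,2)]] by simp
next
  case (Ini_unique f A)
  then show ?case using G_bound by fastforce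
next
  case (K1_nat f1 A1 B1 f2 A2 B2)
  then show ?case
    by (auto simp: G_TProd relcomp_unfold dest: G_boundD simp del: G.simps(10))
next
  case (K2_nat f1 A1 B1 f2 A2 B2)
  then show ?case
    by (auto simp: G_TProd relcomp_unfold dest: G_boundD simp del: G.simps(10))
next
  case (L1_nat f1 A1 B1 f2 A2 B2)
  then show ?case
    by (auto simp: G_TSum relcomp_unfold dest: G_boundD simp del: G.simps(11))
next
  case (L2_nat f1 A1 B1 f2 A2 B2)
  then show ?case
    by (auto simp: G_TSum relcomp_unfold dest: G_boundD simp del: G.simps(11))
next
  case (W_nat f A B)
  then show ?case
    by (auto simp: G_TProd relcomp_unfold dest: G_boundD simp del: G.simps(10))
next
  case (M_nat f A B)
  then show ?case
    by (auto simp: G_TSum relcomp_unfold dest: G_boundD simp del: G.simps(11))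
next
  case (K_W A B)
  show ?case unfolding G.simps occs.simps diag_add by (auto simp: relcomp_unfold)
next
  case (M_L A B)
  show ?case unfolding G.simps occs.simps diag_add by (auto simp: relcomp_unfold)
next
  case (K1_W A) then show ?case by auto
next
  case (K2_W A) then show ?case by auto
next
  case (M_L1 A) then show ?case by auto
next
  case (M_L2 A) then show ?case by auto
qed auto

section \<open>Relations of pairings, copairings and composites with projections and
  injections\<close>

lemma G_pair:
  assumes f: "L \<turnstile> f \<Colon> A \<rightarrow> B" and g: "L \<turnstile> g \<Colon> A \<rightarrow> C"
  shows "G (pair f g) = G f \<union> {(x, y + occs B) | x y. (x, y) \<in> G g}"
  unfolding pair_eq[OF f] G.simps(9) G_TProd[OF f]
  using G_boundD[OF f] G_boundD[OF g] by (auto simp: relcomp_unfold)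

lemma G_copair:
  assumes f: "L \<turnstile> f \<Colon> A \<rightarrow> C" and g: "L \<turnstile> g \<Colon> B \<rightarrow> C"
  shows "G (copair f g) = G f \<union> {(x + occs A, y) | x y. (x, y) \<in> G g}"
proof -
  \<comment> \<open>Composing with \<open>M C\<close> folds the two copies of the target onto each
    other: y is reached either directly or through its copy \<open>y + occs C\<close>.\<close>
  have mem: "(x, y) \<in> R O G (M C) \<longleftrightarrow> y < occs C \<and> ((x, y) \<in> R \<or> (x, y + occs C) \<in> R)" for x y R
    by auto
  have "(x, y) \<in> G (copair f g) \<longleftrightarrow> (x, y) \<in> G f \<union> {(x + occs A, y) | x y. (x, y) \<in> G g}" for x y
    unfolding copair_eq[OF f] G.simps(9) G_TSum[OF f] mem
    by (auto dest: G_boundD[OF f] G_boundD[OF g])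
  then show ?thesis by auto
qed

text \<open>The first component occupies the initial positions, so \<open>K1\<close> and
  \<open>L1\<close> leave the relation of the other arrow unchanged, whereas \<open>K2\<close> and
  \<open>L2\<close> shift it by the size of the component before it.\<close>

lemma G_comp_K1: "L \<turnstile> f \<Colon> A \<rightarrow> C \<Longrightarrow> G (f \<bullet> K1 A B) = G f"
  by (auto simp: relcomp_unfold dest: G_boundD)

lemma G_comp_K2: "L \<turnstile> f \<Colon> B \<rightarrow> C \<Longrightarrow> G (f \<bullet> K2 A B) = {(x + occs A, y) | x y. (x, y) \<in> G f}"
  by (auto simp: relcomp_unfold dest: G_boundD)

lemma G_L1_comp: "L \<turnstile> f \<Colon> A \<rightarrow> B \<Longrightarrow> G (L1 B C \<bullet> f) = G f"
  by (auto simp: relcomp_unfold dest: G_boundD)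

lemma G_L2_comp: "L \<turnstile> f \<Colon> A \<rightarrow> C \<Longrightarrow> G (L2 B C \<bullet> f) = {(x, y + occs B) | x y. (x, y) \<in> G f}"
  by (auto simp: relcomp_unfold dest: G_boundD)

text \<open>Recovers the relation of f' from that of f' after a second projection, so that the
  induction hypothesis applies to f'. The next lemma serves second injections in the same
  way.\<close>

lemma shift_left_inject:
  assumes "{(x + n, y) | x y. (x, y) \<in> R} = {(x + n, y) | x y. (x, y) \<in> S}"
  shows "R = (S :: (nat \<times> 'b) set)"
proof -
  have mem: "(x, y) \<in> T \<longleftrightarrow> (x + n, y) \<in> {(x + n, y) | x y. (x, y) \<in> T}" for x y and T :: "(nat \<times> 'b) set"
    by auto
  have "(x, y) \<in> R \<longleftrightarrow> (x, y) \<in> S" for x y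
    unfolding mem[of x y R] mem[of x y S] assms ..
  then show ?thesis by auto
qed

lemma shift_right_inject:
  assumes "{(x, y + n) | x y. (x, y) \<in> R} = {(x, y + n) | x y. (x, y) \<in> S}"
  shows "R = (S :: ('b \<times> nat) set)"
proof -
  have mem: "(x, y) \<in> T \<longleftrightarrow> (x, y + n) \<in> {(x, y + n) | x y. (x, y) \<in> T}" for x y and T :: "('b \<times> nat) set"
    by auto
  have "(x, y) \<in> R \<longleftrightarrow> (x, y) \<in> S" for x y
    unfolding mem[of x y R] mem[of x y S] assms ..
  then show ?thesis by auto
qed

section \<open>Cut elimination\<close>

text \<open>
  Closing under equality makes this the predicate ``equal to a cut-free term''; the
  remaining rules are those of a sequent calculus for \<open>\<times>\<close>, \<open>+\<close> and \<open>O\<close>.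
\<close>

inductive cutfree :: "'a set \<Rightarrow> 'a tm \<Rightarrow> 'a formula \<Rightarrow> 'a formula \<Rightarrow> bool" for L where
  Idt: "p \<in> L \<Longrightarrow> cutfree L (Idt (Letter p)) (Letter p) (Letter p)"
| Ini: "letters A \<subseteq> L \<Longrightarrow> cutfree L (Ini A) Zero A"
| K1: "cutfree L f A C \<Longrightarrow> letters B \<subseteq> L \<Longrightarrow> cutfree L (f \<bullet> K1 A B) (A \<otimes> B) C"
| K2: "cutfree L f B C \<Longrightarrow> letters A \<subseteq> L \<Longrightarrow> cutfree L (f \<bullet> K2 A B) (A \<otimes> B) C"
| pair: "cutfree L f A B \<Longrightarrow> cutfree L g A C \<Longrightarrow> cutfree L (pair f g) A (B \<otimes> C)"
| L1: "cutfree L f A B \<Longrightarrow> letters C \<subseteq> L \<Longrightarrow> cutfree L (L1 B C \<bullet> f) A (B \<oplus> C)"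
| L2: "cutfree L f A C \<Longrightarrow> letters B \<subseteq> L \<Longrightarrow> cutfree L (L2 B C \<bullet> f) A (B \<oplus> C)"
| copair: "cutfree L f A C \<Longrightarrow> cutfree L g B C \<Longrightarrow> cutfree L (copair f g) (A \<oplus> B) C"
| eq: "cutfree L f A B \<Longrightarrow> L \<turnstile> f \<approx> g \<Colon> A \<rightarrow> B \<Longrightarrow> cutfree L g A B"

section \<open>Admissibility of composition\<close>

lemma cutfree_type:
  assumes "cutfree L f A B"
  shows "L \<turnstile> f \<Colon> A \<rightarrow> B"
  using assms
proof (induction rule: cutfree.induct)
  case (eq f A B g)
  then show ?case by (blast dest: S_eq_typed)
next
  case (Idt p)
  then show ?case by (intro has_type.Idt) simp
next
  case (K1 f A C B)
  then show ?case by (blast intro: typing dest: has_type_letters)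
next
  case (K2 f B C A)
  then show ?case by (blast intro: typing dest: has_type_letters)
next
  case (L1 f A B C)
  then show ?case by (blast intro: typing dest: has_type_letters)
next
  case (L2 f A C B)
  then show ?case by (blast intro: typing dest: has_type_letters)
qed (blast intro: typing)+

lemma cutfree_letters:
  assumes "cutfree L f A B"
  shows "letters A \<subseteq> L" "letters B \<subseteq> L"
  using has_type_letters[OF cutfree_type[OF assms]] by auto

lemma cutfree_eq': "cutfree L f A B \<Longrightarrow> L \<turnstile> g \<approx> f \<Colon> A \<rightarrow> B \<Longrightarrow> cutfree L g A B"
  by (blast intro: cutfree.eq S_eq.sym)

text \<open>The derivation of f suffices here, without induction on a cut formula. A product target
  excludes letter identities and injections; a pairing hands over its component; projections and
  copairings at the source commute with what follows them.\<close>

lemma cutfree_proj: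
  assumes "cutfree L f A D" "D = B \<otimes> C"
  shows "cutfree L (K1 B C \<bullet> f) A B \<and> cutfree L (K2 B C \<bullet> f) A C"
  using assms
proof (induction rule: cutfree.induct)
  case (Idt p)
  then show ?case by simp
next
  case (Ini D)
  then have l: "letters B \<subseteq> L" "letters C \<subseteq> L" by auto
  have "L \<turnstile> K1 B C \<bullet> Ini D \<approx> Ini B \<Colon> Zero \<rightarrow> B" "L \<turnstile> K2 B C \<bullet> Ini D \<approx> Ini C \<Colon> Zero \<rightarrow> C"
    using Ini l by (auto intro!: Ini_unique typing)
  with l show ?case by (blast intro: cutfree.Ini cutfree_eq')
next
  case (K1 f A D A')
  note t = cutfree_type[OF K1(1), unfolded K1(4)] and l = K1(2) cutfree_letters[OF K1(1), unfolded K1(4)]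
  have "letters B \<subseteq> L" "letters C \<subseteq> L" using l by auto
  note l = l this
  show ?case using K1 l
    by (auto intro!: cutfree.K1 cutfree_eq'[OF cutfree.K1] S_eq.assoc t typing)
next
  case (K2 f A D A')
  note t = cutfree_type[OF K2(1), unfolded K2(4)] and l = K2(2) cutfree_letters[OF K2(1), unfolded K2(4)]
  have "letters B \<subseteq> L" "letters C \<subseteq> L" using l by auto
  note l = l this
  show ?case using K2 l
    by (auto intro!: cutfree_eq'[OF cutfree.K2] S_eq.assoc t typing)
next
  case (pair f A B' g C')
  then have "B' = B" "C' = C" by auto
  with pair show ?case
    by (blast intro: cutfree_eq' K1_pair K2_pair cutfree_type)
next
  case (L1 f A B C)
  then show ?case by simp
next
  case (L2 f A C B)
  then show ?case by simp
next
  case (copair f A D g A')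
  note t = cutfree_type[OF copair(1), unfolded copair(5)] cutfree_type[OF copair(2), unfolded copair(5)]
  have l: "letters B \<subseteq> L" "letters C \<subseteq> L" using has_type_letters[OF t(1)] by auto
  show ?case using copair l
    by (auto intro!: cutfree_eq'[OF cutfree.copair] comp_copair t typing)
next
  case (eq f A D g)
  then have e: "L \<turnstile> f \<approx> g \<Colon> A \<rightarrow> B \<otimes> C" by simp
  have l: "letters B \<subseteq> L" "letters C \<subseteq> L" using S_eq_typed[OF e] by auto
  show ?case using eq l
    by (auto intro!: cutfree.eq[OF _ comp_cong_right[OF e]] typing)
qed

text \<open>\<open>IH1\<close> and \<open>IH2\<close> stand for the outer induction of
  \<open>cutfree_comp\<close> at the two summands, which are smaller cut formulas. An injection at
  the end of f selects one branch of the copairing; the rules that act on the source of f are moved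
  outwards until an injection or \<open>Ini\<close> is met.\<close>

lemma cutfree_comp_copair:
  assumes f: "cutfree L f A D" "D = B1 \<oplus> B2"
    and g: "cutfree L g1 B1 C" "cutfree L g2 B2 C"
    and IH1: "\<And>A f. cutfree L f A B1 \<Longrightarrow> cutfree L (g1 \<bullet> f) A C"
    and IH2: "\<And>A f. cutfree L f A B2 \<Longrightarrow> cutfree L (g2 \<bullet> f) A C"
  shows "cutfree L (copair g1 g2 \<bullet> f) A C"
proof -
  note g' = g[THEN cutfree_type]
  note l = has_type_letters[OF g'(1)] has_type_letters[OF g'(2)]
  have g: "L \<turnstile> copair g1 g2 \<Colon> B1 \<oplus> B2 \<rightarrow> C" by (rule typing g')+
  show ?thesis using f
  proof (induction rule: cutfree.induct)
    case (Idt p)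
    then show ?case by simp
  next
    case (Ini D)
    then have "L \<turnstile> copair g1 g2 \<bullet> Ini D \<approx> Ini C \<Colon> Zero \<rightarrow> C"
      using g by (auto intro!: Ini_unique typing)
    with l show ?case by (blast intro: cutfree.Ini cutfree_eq')
  next
    case (K1 f A D A')
    note t = cutfree_type[OF K1(1), unfolded K1(4)]
    show ?case using K1 cutfree_letters[OF K1(1)]
      by (auto intro!: cutfree_eq'[OF cutfree.K1] S_eq.assoc[OF _ t g] typing)
  next
    case (K2 f A D A')
    note t = cutfree_type[OF K2(1), unfolded K2(4)]
    show ?case using K2 cutfree_letters[OF K2(1)]
      by (auto intro!: cutfree_eq'[OF cutfree.K2] S_eq.assoc[OF _ t g] typing)
  next
    case (pair f A B' g' C')
    then show ?case by simp
  next
    case (L1 f A B C')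
    then have f: "cutfree L f A B1" and [simp]: "B = B1" "C' = B2" by auto
    note t = cutfree_type[OF f]
    have "L \<turnstile> copair g1 g2 \<bullet> (L1 B1 B2 \<bullet> f) \<approx> (copair g1 g2 \<bullet> L1 B1 B2) \<bullet> f \<Colon> A \<rightarrow> C"
      by (rule S_eq.assoc t g typing l)+
    also have "L \<turnstile> (copair g1 g2 \<bullet> L1 B1 B2) \<bullet> f \<approx> g1 \<bullet> f \<Colon> A \<rightarrow> C"
      by (rule comp_cong_left copair_L1 g' t)+
    finally show ?case using IH1[OF f] by (auto intro: cutfree_eq')
  next
    case (L2 f A C' B)
    then have f: "cutfree L f A B2" and [simp]: "B = B1" "C' = B2" by auto
    note t = cutfree_type[OF f]
    have "L \<turnstile> copair g1 g2 \<bullet> (L2 B1 B2 \<bullet> f) \<approx> (copair g1 g2 \<bullet> L2 B1 B2) \<bullet> f \<Colon> A \<rightarrow> C"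
      by (rule S_eq.assoc t g typing l)+
    also have "L \<turnstile> (copair g1 g2 \<bullet> L2 B1 B2) \<bullet> f \<approx> g2 \<bullet> f \<Colon> A \<rightarrow> C"
      by (rule comp_cong_left copair_L2 g' t)+
    finally show ?case using IH2[OF f] by (auto intro: cutfree_eq')
  next
    case (copair f1 A D f2 A')
    note t = cutfree_type[OF copair(1), unfolded copair(5)] cutfree_type[OF copair(2), unfolded copair(5)]
    show ?case using copair
      by (auto intro!: cutfree_eq'[OF cutfree.copair] comp_copair[OF t g])
  next
    case (eq f A D f')
    then have e: "L \<turnstile> f \<approx> f' \<Colon> A \<rightarrow> B1 \<oplus> B2" by simp
    show ?case using eq
      by (auto intro!: cutfree.eq[OF _ comp_cong_right[OF e g]])
  qed
qed

text \<open>No rule acting on the target ends in \<open>Zero\<close>, so f is built from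
  \<open>Ini Zero\<close> by projections and copairings alone, up to equality. These commute
  outwards, and at the leaves initiality replaces the composite by \<open>Ini C\<close>.\<close>

lemma cutfree_comp_Ini:
  assumes f: "cutfree L f A D" "D = Zero" and l: "letters C \<subseteq> L"
  shows "cutfree L (Ini C \<bullet> f) A C"
  using f
proof (induction rule: cutfree.induct)
  case (Ini D)
  then have "L \<turnstile> Ini C \<bullet> Ini D \<approx> Ini C \<Colon> Zero \<rightarrow> C"
    using l by (auto intro!: Ini_unique typing)
  with l show ?case by (blast intro: cutfree.Ini cutfree_eq')
next
  case (K1 f A D A')
  note t = cutfree_type[OF K1(1), unfolded K1(4)]
  show ?case using K1 cutfree_letters[OF K1(1)] l
    by (auto intro!: cutfree_eq'[OF cutfree.K1] S_eq.assoc[OF _ t] typing)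
next
  case (K2 f A D A')
  note t = cutfree_type[OF K2(1), unfolded K2(4)]
  show ?case using K2 cutfree_letters[OF K2(1)] l
    by (auto intro!: cutfree_eq'[OF cutfree.K2] S_eq.assoc[OF _ t] typing)
next
  case (copair f1 A D f2 A')
  note t = cutfree_type[OF copair(1), unfolded copair(5)] cutfree_type[OF copair(2), unfolded copair(5)]
  show ?case using copair l
    by (auto intro!: cutfree_eq'[OF cutfree.copair] comp_copair[OF t] typing)
next
  case (eq f A D f')
  then have e: "L \<turnstile> f \<approx> f' \<Colon> A \<rightarrow> Zero" by simp
  show ?case using eq l
    by (auto intro!: cutfree.eq[OF _ comp_cong_right[OF e]] typing)
qed auto

text \<open>
  Induction on the cut formula B, then on the derivation of g. A projection at the start
  of g is moved over to f by \<open>cutfree_proj\<close>, and a copairing meets an injection in f; both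
  lower the cut formula.
\<close>

lemma cutfree_comp:
  assumes "cutfree L f A B" "cutfree L g B C"
  shows "cutfree L (g \<bullet> f) A C"
  using assms
proof (induction B arbitrary: A C f g rule: measure_induct_rule[of size])
  case (less B)
  note IH = less(1)
  \<comment> \<open>The cut formula is the source of g and changes along the derivation of g. The
    outer hypothesis is therefore carried through the inner induction together with f.\<close>
  from less(3,2) less(1) show ?case
  proof (induction arbitrary: A f rule: cutfree.induct)
    case (Idt p)
    then show ?case by (blast intro: cutfree_eq' id_left cutfree_type)
  next
    case (Ini C)
    then show ?case by (blast intro: cutfree_comp_Ini)
  next
    case (K1 g B1 C B2)
    note t = cutfree_type[OF K1(1)] cutfree_type[OF K1(4)]
    have l: "letters B1 \<subseteq> L" "letters B2 \<subseteq> L" using has_type_letters[OF t(2)] by auto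
    have "cutfree L (K1 B1 B2 \<bullet> f) A B1" using cutfree_proj[OF K1(4)] by simp
    then have "cutfree L (g \<bullet> K1 B1 B2 \<bullet> f) A C" using K1(1) by (rule K1(5)[rotated]) simp
    moreover have "L \<turnstile> (g \<bullet> K1 B1 B2) \<bullet> f \<approx> g \<bullet> K1 B1 B2 \<bullet> f \<Colon> A \<rightarrow> C"
      by (rule assoc' t l typing)+
    ultimately show ?case by (rule cutfree_eq')
  next
    case (K2 g B2 C B1)
    note t = cutfree_type[OF K2(1)] cutfree_type[OF K2(4)]
    have l: "letters B1 \<subseteq> L" "letters B2 \<subseteq> L" using has_type_letters[OF t(2)] by auto
    have "cutfree L (K2 B1 B2 \<bullet> f) A B2" using cutfree_proj[OF K2(4)] by simp
    then have "cutfree L (g \<bullet> K2 B1 B2 \<bullet> f) A C" using K2(1) by (rule K2(5)[rotated]) simp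
    moreover have "L \<turnstile> (g \<bullet> K2 B1 B2) \<bullet> f \<approx> g \<bullet> K2 B1 B2 \<bullet> f \<Colon> A \<rightarrow> C"
      by (rule assoc' t l typing)+
    ultimately show ?case by (rule cutfree_eq')
  next
    case (pair g B C g' C')
    \<comment> \<open>A rule acting on the target of g keeps the cut formula, so the hypothesis on
      the derivation is used here rather than the one on size.\<close>
    have "cutfree L (g \<bullet> f) A C" by (rule pair(3)[OF pair(5)], rule pair(6))
    moreover have "cutfree L (g' \<bullet> f) A C'" by (rule pair(4)[OF pair(5)], rule pair(6))
    ultimately show ?case
      by (rule cutfree_eq'[OF cutfree.pair pair_comp]) (rule pair cutfree_type)+
  next
    case (L1 g B C C')
    have "cutfree L (g \<bullet> f) A C" by (rule L1(3)[OF L1(4)], rule L1(5))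
    then show ?case
      by (rule cutfree_eq'[OF cutfree.L1 assoc']) (rule L1 cutfree_type typing cutfree_letters[OF L1(1)])+
  next
    case (L2 g B C' C)
    have "cutfree L (g \<bullet> f) A C'" by (rule L2(3)[OF L2(4)], rule L2(5))
    then show ?case
      by (rule cutfree_eq'[OF cutfree.L2 assoc']) (rule L2 cutfree_type typing cutfree_letters[OF L2(1)])+
  next
    case (copair g1 B1 C g2 B2)
    show ?case
    proof (rule cutfree_comp_copair[OF copair(5) HOL.refl copair(1,2)])
      show "cutfree L (g1 \<bullet> f) A C" if "cutfree L f A B1" for f A
        using that copair(1) by (rule copair(6)[rotated]) simp
      show "cutfree L (g2 \<bullet> f) A C" if "cutfree L f A B2" for f A
        using that copair(2) by (rule copair(6)[rotated]) simp
    qed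
  next
    case (eq g B C g')
    have "cutfree L (g \<bullet> f) A C" by (rule eq(3)[OF eq(4)], rule eq(5))
    then show ?case
      by (rule cutfree.eq[OF _ comp_cong_left[OF eq(2) cutfree_type[OF eq(4)]]])
  qed
qed

section \<open>Cut-free forms of all terms\<close>

text \<open>Eta-expansion: the calculus has identities at letters only, and compound ones are
  rebuilt from their components by \<open>K_W\<close> and \<open>M_L\<close>. This restriction
  leaves a single identity case, between letters, in the later inversion.\<close>

lemma cutfree_Idt: "letters A \<subseteq> L \<Longrightarrow> cutfree L (Idt A) A A"
proof (induction A)
  case (Letter p)
  then show ?case by (auto intro: cutfree.Idt)
next
  case Zero
  have "L \<turnstile> Idt Zero \<approx> Ini Zero \<Colon> Zero \<rightarrow> Zero" by (auto intro!: Ini_unique typing)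
  then show ?case by (auto intro!: cutfree_eq'[OF cutfree.Ini])
next
  case (Prod A B)
  then have l: "letters A \<subseteq> L" "letters B \<subseteq> L" "letters (A \<otimes> B) \<subseteq> L" by auto
  have K: "cutfree L (K1 A B) (A \<otimes> B) A" "cutfree L (K2 A B) (A \<otimes> B) B"
    using Prod l by (auto intro!: cutfree.eq[OF cutfree.K1 id_left] cutfree.eq[OF cutfree.K2 id_left] typing)
  then show ?case
    using cutfree.eq[OF cutfree.pair[OF K]] K_W[OF l(1,2)]
    by (simp add: pair_eq[OF cutfree_type[OF K(1)]])
next
  case (Sum A B)
  then have l: "letters A \<subseteq> L" "letters B \<subseteq> L" "letters (A \<oplus> B) \<subseteq> L" by auto
  have K: "cutfree L (L1 A B) A (A \<oplus> B)" "cutfree L (L2 A B) B (A \<oplus> B)"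
    using Sum l by (auto intro!: cutfree.eq[OF cutfree.L1 id_right] cutfree.eq[OF cutfree.L2 id_right] typing)
  then show ?case
    using cutfree.eq[OF cutfree.copair[OF K]] M_L[OF l(1,2)]
    by (simp add: copair_eq[OF cutfree_type[OF K(1)]])
qed

lemma cutfree_K1:
  assumes "letters A \<subseteq> L" "letters B \<subseteq> L" shows "cutfree L (K1 A B) (A \<otimes> B) A"
  by (rule cutfree.eq[OF cutfree.K1 id_left] cutfree_Idt typing assms)+

lemma cutfree_K2:
  assumes "letters A \<subseteq> L" "letters B \<subseteq> L" shows "cutfree L (K2 A B) (A \<otimes> B) B"
  by (rule cutfree.eq[OF cutfree.K2 id_left] cutfree_Idt typing assms)+

lemma cutfree_L1:
  assumes "letters A \<subseteq> L" "letters B \<subseteq> L" shows "cutfree L (L1 A B) A (A \<oplus> B)"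
  by (rule cutfree.eq[OF cutfree.L1 id_right] cutfree_Idt typing assms)+

lemma cutfree_L2:
  assumes "letters A \<subseteq> L" "letters B \<subseteq> L" shows "cutfree L (L2 A B) B (A \<oplus> B)"
  by (rule cutfree.eq[OF cutfree.L2 id_right] cutfree_Idt typing assms)+

text \<open>Composition is covered by \<open>cutfree_comp\<close>. The terms \<open>W\<close> and
  \<open>M\<close> are the pairing and copairing of two identities, and products and sums of arrows
  are recovered from their components by \<open>pair_eta\<close> and
  \<open>copair_eta\<close>.\<close>

theorem cut_elimination:
  assumes "L \<turnstile> f \<Colon> A \<rightarrow> B"
  shows "cutfree L f A B"
  using assms
proof (induction rule: has_type.induct)
  case (W A)
  have t: "L \<turnstile> Idt A \<Colon> A \<rightarrow> A" by (rule typing W)+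
  have "L \<turnstile> pair (Idt A) (Idt A) \<approx> Idt (A \<otimes> A) \<bullet> W A \<Colon> A \<rightarrow> A \<otimes> A" (is "S_eq _ _ ?t _ _")
    unfolding pair_eq[OF t] by (rule comp_cong_left prod_id typing W)+
  also have "L \<turnstile> ?t \<approx> W A \<Colon> A \<rightarrow> A \<otimes> A" by (rule id_left typing W)+
  finally show ?case
    by (rule cutfree.eq[OF cutfree.pair[OF cutfree_Idt[OF W] cutfree_Idt[OF W]]])
next
  case (M A)
  have t: "L \<turnstile> Idt A \<Colon> A \<rightarrow> A" by (rule typing M)+
  have "L \<turnstile> copair (Idt A) (Idt A) \<approx> M A \<bullet> Idt (A \<oplus> A) \<Colon> A \<oplus> A \<rightarrow> A" (is "S_eq _ _ ?t _ _")
    unfolding copair_eq[OF t] by (rule comp_cong_right sum_id typing M)+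
  also have "L \<turnstile> ?t \<approx> M A \<Colon> A \<oplus> A \<rightarrow> A" by (rule id_right typing M)+
  finally show ?case
    by (rule cutfree.eq[OF cutfree.copair[OF cutfree_Idt[OF M] cutfree_Idt[OF M]]])
next
  case (TProd f A B g C D)
  note l = has_type_letters[OF TProd(1)] has_type_letters[OF TProd(2)]
  have fg: "L \<turnstile> f \<otimes>\<^sub>t g \<Colon> A \<otimes> C \<rightarrow> B \<otimes> D" by (rule typing TProd)+
  have c: "cutfree L (K1 B D \<bullet> (f \<otimes>\<^sub>t g)) (A \<otimes> C) B" "cutfree L (K2 B D \<bullet> (f \<otimes>\<^sub>t g)) (A \<otimes> C) D"
    by (rule cutfree_eq'[OF _ K1_nat] cutfree_eq'[OF _ K2_nat] cutfree.K1 cutfree.K2 TProd l)+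
  show ?case by (rule cutfree.eq[OF cutfree.pair[OF c] pair_eta[OF fg]])
next
  case (TSum f A B g C D)
  note l = has_type_letters[OF TSum(1)] has_type_letters[OF TSum(2)]
  have fg: "L \<turnstile> f \<oplus>\<^sub>t g \<Colon> A \<oplus> C \<rightarrow> B \<oplus> D" by (rule typing TSum)+
  have c: "cutfree L ((f \<oplus>\<^sub>t g) \<bullet> L1 A C) A (B \<oplus> D)" "cutfree L ((f \<oplus>\<^sub>t g) \<bullet> L2 A C) C (B \<oplus> D)"
    by (rule cutfree_eq'[OF _ L1_nat] cutfree_eq'[OF _ L2_nat] cutfree.L1 cutfree.L2 TSum l)+
  show ?case by (rule cutfree.eq[OF cutfree.copair[OF c] copair_eta[OF fg]])
qed (blast intro: cutfree.Ini cutfree_Idt cutfree_K1 cutfree_K2 cutfree_L1 cutfree_L2 cutfree_comp)+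

section \<open>Coherence\<close>

text \<open>Initiality lets the arrow out of O absorb whatever follows it.\<close>

lemma comp_Ini_comp:
  assumes g: "L \<turnstile> g \<Colon> B \<rightarrow> C" and h: "L \<turnstile> h \<Colon> A \<rightarrow> Zero"
  shows "L \<turnstile> g \<bullet> (Ini B \<bullet> h) \<approx> Ini C \<bullet> h \<Colon> A \<rightarrow> C"
proof -
  note l = has_type_letters[OF g]
  have "L \<turnstile> g \<bullet> (Ini B \<bullet> h) \<approx> (g \<bullet> Ini B) \<bullet> h \<Colon> A \<rightarrow> C" (is "S_eq _ _ ?t _ _")
    by (rule S_eq.assoc g h l typing)+
  also have "L \<turnstile> ?t \<approx> Ini C \<bullet> h \<Colon> A \<rightarrow> C"
    by (rule comp_cong_left Ini_unique g h l typing)+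
  finally show ?thesis .
qed

text \<open>Each rule keeps the pairs of its premises, possibly shifted, so an empty relation is
  inherited by all premises. A letter identity would contribute a pair; hence every leaf is an
  \<open>Ini\<close>, and the factorization is carried down from there. A composite would not do: it
  may have the empty relation although neither factor has.\<close>

lemma empty_factors_Zero:
  assumes "cutfree L f A B" "G f = {}"
  shows "\<exists>h. (L \<turnstile> h \<Colon> A \<rightarrow> Zero) \<and> (L \<turnstile> f \<approx> Ini B \<bullet> h \<Colon> A \<rightarrow> B)"
  using assms
proof (induction rule: cutfree.induct)
  case (Idt p)
  then show ?case by simp
next
  case (Ini A)
  have "L \<turnstile> Ini A \<approx> Ini A \<bullet> Idt Zero \<Colon> Zero \<rightarrow> A"
    by (rule S_eq.sym[OF id_right] typing Ini)+
  then show ?case by (auto intro!: exI[of _ "Idt Zero"] typing)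
next
  case (K1 f A C B)
  then obtain h where h: "L \<turnstile> h \<Colon> A \<rightarrow> Zero" "L \<turnstile> f \<approx> Ini C \<bullet> h \<Colon> A \<rightarrow> C"
    using G_comp_K1[OF cutfree_type[OF K1(1)]] by auto
  note l = K1(2) cutfree_letters[OF K1(1)]
  have "L \<turnstile> f \<bullet> K1 A B \<approx> (Ini C \<bullet> h) \<bullet> K1 A B \<Colon> A \<otimes> B \<rightarrow> C" (is "S_eq _ _ ?t _ _")
    by (rule comp_cong_left h l typing)+
  also have "L \<turnstile> ?t \<approx> Ini C \<bullet> (h \<bullet> K1 A B) \<Colon> A \<otimes> B \<rightarrow> C"
    by (rule assoc' h l typing)+
  finally show ?case using h l by (blast intro: typing)
next
  case (K2 f B C A)
  have "G f = {}"
    using K2(4) unfolding G_comp_K2[OF cutfree_type[OF K2(1)]] by auto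
  with K2(3) obtain h where h: "L \<turnstile> h \<Colon> B \<rightarrow> Zero" "L \<turnstile> f \<approx> Ini C \<bullet> h \<Colon> B \<rightarrow> C"
    by auto
  note l = K2(2) cutfree_letters[OF K2(1)]
  have "L \<turnstile> f \<bullet> K2 A B \<approx> (Ini C \<bullet> h) \<bullet> K2 A B \<Colon> A \<otimes> B \<rightarrow> C" (is "S_eq _ _ ?t _ _")
    by (rule comp_cong_left h l typing)+
  also have "L \<turnstile> ?t \<approx> Ini C \<bullet> (h \<bullet> K2 A B) \<Colon> A \<otimes> B \<rightarrow> C"
    by (rule assoc' h l typing)+
  finally show ?case using h l by (blast intro: typing)
next
  case (pair f A B g C)
  have "G f = {}" "G g = {}"
    using pair(5) G_pair[OF cutfree_type[OF pair(1)] cutfree_type[OF pair(2)]] by auto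
  then obtain h h' where h: "L \<turnstile> h \<Colon> A \<rightarrow> Zero" "L \<turnstile> f \<approx> Ini B \<bullet> h \<Colon> A \<rightarrow> B"
    and h': "L \<turnstile> h' \<Colon> A \<rightarrow> Zero" "L \<turnstile> g \<approx> Ini C \<bullet> h' \<Colon> A \<rightarrow> C"
    using pair(3,4) by auto
  note l = cutfree_letters[OF pair(1)] cutfree_letters[OF pair(2)]
  \<comment> \<open>The two components may reach O by different arrows h' and h. Subterminality
    identifies them, so one h serves the whole pairing.\<close>
  have "L \<turnstile> Ini C \<bullet> h' \<approx> Ini C \<bullet> h \<Colon> A \<rightarrow> C"
    by (rule comp_cong_right Zero_subterminal h h' l typing)+
  with h'(2) have g: "L \<turnstile> g \<approx> Ini C \<bullet> h \<Colon> A \<rightarrow> C" by (rule S_eq.trans)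
  have "L \<turnstile> pair f g \<approx> pair (Ini B \<bullet> h) (Ini C \<bullet> h) \<Colon> A \<rightarrow> B \<otimes> C" (is "S_eq _ _ ?t _ _")
    by (rule pair_cong h g)+
  also have "L \<turnstile> ?t \<approx> pair (Ini B) (Ini C) \<bullet> h \<Colon> A \<rightarrow> B \<otimes> C" (is "S_eq _ _ ?t _ _")
    by (rule S_eq.sym[OF pair_comp] h l typing)+
  also have "L \<turnstile> ?t \<approx> Ini (B \<otimes> C) \<bullet> h \<Colon> A \<rightarrow> B \<otimes> C"
    by (rule comp_cong_left Ini_unique h l typing)+
  finally show ?case using h by blast
next
  case (L1 f A B C)
  then obtain h where h: "L \<turnstile> h \<Colon> A \<rightarrow> Zero" "L \<turnstile> f \<approx> Ini B \<bullet> h \<Colon> A \<rightarrow> B"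
    using G_L1_comp[OF cutfree_type[OF L1(1)]] by auto
  note l = L1(2) cutfree_letters[OF L1(1)]
  have "L \<turnstile> L1 B C \<bullet> f \<approx> L1 B C \<bullet> (Ini B \<bullet> h) \<Colon> A \<rightarrow> B \<oplus> C" (is "S_eq _ _ ?t _ _")
    by (rule comp_cong_right h l typing)+
  also have "L \<turnstile> ?t \<approx> Ini (B \<oplus> C) \<bullet> h \<Colon> A \<rightarrow> B \<oplus> C"
    by (rule comp_Ini_comp h l typing)+
  finally show ?case using h by blast
next
  case (L2 f A C B)
  have "G f = {}"
    using L2(4) unfolding G_L2_comp[OF cutfree_type[OF L2(1)]] by auto
  with L2(3) obtain h where h: "L \<turnstile> h \<Colon> A \<rightarrow> Zero" "L \<turnstile> f \<approx> Ini C \<bullet> h \<Colon> A \<rightarrow> C"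
    by auto
  note l = L2(2) cutfree_letters[OF L2(1)]
  have "L \<turnstile> L2 B C \<bullet> f \<approx> L2 B C \<bullet> (Ini C \<bullet> h) \<Colon> A \<rightarrow> B \<oplus> C" (is "S_eq _ _ ?t _ _")
    by (rule comp_cong_right h l typing)+
  also have "L \<turnstile> ?t \<approx> Ini (B \<oplus> C) \<bullet> h \<Colon> A \<rightarrow> B \<oplus> C"
    by (rule comp_Ini_comp h l typing)+
  finally show ?case using h by blast
next
  case (copair f A C g B)
  have "G f = {}" "G g = {}"
    using copair(5) G_copair[OF cutfree_type[OF copair(1)] cutfree_type[OF copair(2)]] by auto
  then obtain h h' where h: "L \<turnstile> h \<Colon> A \<rightarrow> Zero" "L \<turnstile> f \<approx> Ini C \<bullet> h \<Colon> A \<rightarrow> C"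
    and h': "L \<turnstile> h' \<Colon> B \<rightarrow> Zero" "L \<turnstile> g \<approx> Ini C \<bullet> h' \<Colon> B \<rightarrow> C"
    using copair(3,4) by auto
  note l = cutfree_letters[OF copair(1)]
  have "L \<turnstile> copair f g \<approx> copair (Ini C \<bullet> h) (Ini C \<bullet> h') \<Colon> A \<oplus> B \<rightarrow> C" (is "S_eq _ _ ?t _ _")
    by (rule copair_cong h h')+
  also have "L \<turnstile> ?t \<approx> Ini C \<bullet> copair h h' \<Colon> A \<oplus> B \<rightarrow> C"
    by (rule S_eq.sym[OF comp_copair] h h' l typing)+
  finally show ?case using h h' by (blast intro: typing)
next
  case (eq f A B g)
  then show ?case using G_sound[OF eq(2)] by (metis S_eq.sym S_eq.trans)
qed

lemma empty_coherence:
  assumes f: "L \<turnstile> f \<Colon> A \<rightarrow> B" and g: "L \<turnstile> g \<Colon> A \<rightarrow> B"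
    and "G f = {}" "G g = {}"
  shows "L \<turnstile> f \<approx> g \<Colon> A \<rightarrow> B"
proof -
  obtain h h' where h: "L \<turnstile> h \<Colon> A \<rightarrow> Zero" "L \<turnstile> f \<approx> Ini B \<bullet> h \<Colon> A \<rightarrow> B"
    and h': "L \<turnstile> h' \<Colon> A \<rightarrow> Zero" "L \<turnstile> g \<approx> Ini B \<bullet> h' \<Colon> A \<rightarrow> B"
    using empty_factors_Zero[OF cut_elimination] assms by metis
  have "L \<turnstile> Ini B \<bullet> h \<approx> Ini B \<bullet> h' \<Colon> A \<rightarrow> B"
    by (rule comp_cong_right Zero_subterminal h h' typing has_type_letters[OF f])+
  with h h' show ?thesis by (metis S_eq.sym S_eq.trans)
qed

text \<open>
  An arrow whose relation lies over one summand of the target factors through that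
  injection: a component through the other summand has the empty relation, hence
  factors through O. The dual fact for products fails, as the identity of
  \<open>p \<times> O\<close> shows.
\<close>

lemma factors_L1:
  assumes "cutfree L f A D" "D = B \<oplus> C" "\<And>x y. (x, y) \<in> G f \<Longrightarrow> y < occs B"
  shows "\<exists>f'. (L \<turnstile> f' \<Colon> A \<rightarrow> B) \<and> (L \<turnstile> f \<approx> L1 B C \<bullet> f' \<Colon> A \<rightarrow> B \<oplus> C)"
  using assms
proof (induction rule: cutfree.induct)
  case (Idt p)
  then show ?case by simp
next
  case (Ini D)
  then have l: "letters B \<subseteq> L" "letters C \<subseteq> L" by auto
  have "L \<turnstile> Ini D \<approx> L1 B C \<bullet> Ini B \<Colon> Zero \<rightarrow> B \<oplus> C"
    unfolding Ini(2) by (rule S_eq.sym[OF Ini_unique] l typing)+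
  then show ?case using l by (blast intro: typing)
next
  case (K1 f A D A')
  then obtain f' where f': "L \<turnstile> f' \<Colon> A \<rightarrow> B" "L \<turnstile> f \<approx> L1 B C \<bullet> f' \<Colon> A \<rightarrow> B \<oplus> C"
    using G_comp_K1[OF cutfree_type[OF K1(1)]] by blast
  have l: "letters A \<subseteq> L" "letters A' \<subseteq> L" "letters B \<subseteq> L" "letters C \<subseteq> L"
    using K1(2) S_eq_typed[OF f'(2)] by auto
  have "L \<turnstile> f \<bullet> K1 A A' \<approx> (L1 B C \<bullet> f') \<bullet> K1 A A' \<Colon> A \<otimes> A' \<rightarrow> B \<oplus> C" (is "S_eq _ _ ?t _ _")
    by (rule comp_cong_left f' l typing)+
  also have "L \<turnstile> ?t \<approx> L1 B C \<bullet> (f' \<bullet> K1 A A') \<Colon> A \<otimes> A' \<rightarrow> B \<oplus> C"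
    by (rule assoc' f' l typing)+
  finally show ?case using f' l by (blast intro: typing)
next
  case (K2 f A D A')
  then obtain f' where f': "L \<turnstile> f' \<Colon> A \<rightarrow> B" "L \<turnstile> f \<approx> L1 B C \<bullet> f' \<Colon> A \<rightarrow> B \<oplus> C"
    using G_comp_K2[OF cutfree_type[OF K2(1)]] by blast
  have l: "letters A \<subseteq> L" "letters A' \<subseteq> L" "letters B \<subseteq> L" "letters C \<subseteq> L"
    using K2(2) S_eq_typed[OF f'(2)] by auto
  have "L \<turnstile> f \<bullet> K2 A' A \<approx> (L1 B C \<bullet> f') \<bullet> K2 A' A \<Colon> A' \<otimes> A \<rightarrow> B \<oplus> C" (is "S_eq _ _ ?t _ _")
    by (rule comp_cong_left f' l typing)+
  also have "L \<turnstile> ?t \<approx> L1 B C \<bullet> (f' \<bullet> K2 A' A) \<Colon> A' \<otimes> A \<rightarrow> B \<oplus> C"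
    by (rule assoc' f' l typing)+
  finally show ?case using f' l by (blast intro: typing)
next
  case (pair f A B' g C')
  then show ?case by simp
next
  case (L1 f A B' C')
  then have f: "L \<turnstile> f \<Colon> A \<rightarrow> B" and [simp]: "B' = B" "C' = C"
    by (auto dest: cutfree_type)
  have "L \<turnstile> L1 B C \<bullet> f \<Colon> A \<rightarrow> B \<oplus> C"
    using L1 f by (auto intro!: typing dest: has_type_letters)
  then show ?case using f by (auto intro: S_eq.refl)
next
  case (L2 f A C' B')
  then have f: "cutfree L f A C" and [simp]: "B' = B" "C' = C" by auto
  note l = L2(2) cutfree_letters[OF f]
  \<comment> \<open>A pair of \<open>G f\<close> would end, after \<open>L2 B C\<close>, at or
    beyond \<open>occs B\<close>, against the assumption.\<close>
  have "G f = {}"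
    using L2(5) G_L2_comp[OF cutfree_type[OF f], of B] by fastforce
  then obtain h where h: "L \<turnstile> h \<Colon> A \<rightarrow> Zero" "L \<turnstile> f \<approx> Ini C \<bullet> h \<Colon> A \<rightarrow> C"
    using empty_factors_Zero[OF f] by auto
  have l: "letters B \<subseteq> L" "letters C \<subseteq> L" using l by auto
  have "L \<turnstile> L2 B C \<bullet> f \<approx> L2 B C \<bullet> (Ini C \<bullet> h) \<Colon> A \<rightarrow> B \<oplus> C" (is "S_eq _ _ ?t _ _")
    by (rule comp_cong_right h l typing)+
  \<comment> \<open>Once the arrow passes through O the two injections can be exchanged, as both
    composites equal \<open>Ini (B \<oplus> C)\<close> after h.\<close>
  also have "L \<turnstile> ?t \<approx> Ini (B \<oplus> C) \<bullet> h \<Colon> A \<rightarrow> B \<oplus> C" (is "S_eq _ _ ?t _ _")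
    by (rule comp_Ini_comp h l typing)+
  also have "L \<turnstile> ?t \<approx> L1 B C \<bullet> (Ini B \<bullet> h) \<Colon> A \<rightarrow> B \<oplus> C"
    by (rule S_eq.sym[OF comp_Ini_comp] h l typing)+
  finally show ?case using h l by (auto intro!: exI[of _ "Ini B \<bullet> h"] typing)
next
  case (copair f A D g A')
  note G = G_copair[OF cutfree_type[OF copair(1)] cutfree_type[OF copair(2)]]
  obtain f' where f': "L \<turnstile> f' \<Colon> A \<rightarrow> B" "L \<turnstile> f \<approx> L1 B C \<bullet> f' \<Colon> A \<rightarrow> B \<oplus> C"
    using copair(3,5,6) G by blast
  obtain g' where g': "L \<turnstile> g' \<Colon> A' \<rightarrow> B" "L \<turnstile> g \<approx> L1 B C \<bullet> g' \<Colon> A' \<rightarrow> B \<oplus> C"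
    using copair(4,5,6) G by blast
  have l: "letters B \<subseteq> L" "letters C \<subseteq> L" using S_eq_typed[OF f'(2)] by auto
  have "L \<turnstile> copair f g \<approx> copair (L1 B C \<bullet> f') (L1 B C \<bullet> g') \<Colon> A \<oplus> A' \<rightarrow> B \<oplus> C" (is "S_eq _ _ ?t _ _")
    by (rule copair_cong f' g')+
  also have "L \<turnstile> ?t \<approx> L1 B C \<bullet> copair f' g' \<Colon> A \<oplus> A' \<rightarrow> B \<oplus> C"
    by (rule S_eq.sym[OF comp_copair] f' g' l typing)+
  finally show ?case using f' g' by (blast intro: typing)
next
  case (eq f A D g)
  then show ?case using G_sound[OF eq(2)] by (metis S_eq.sym S_eq.trans)
qed

lemma factors_L2:
  assumes "cutfree L f A D" "D = B \<oplus> C" "\<And>x y. (x, y) \<in> G f \<Longrightarrow> occs B \<le> y"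
  shows "\<exists>f'. (L \<turnstile> f' \<Colon> A \<rightarrow> C) \<and> (L \<turnstile> f \<approx> L2 B C \<bullet> f' \<Colon> A \<rightarrow> B \<oplus> C)"
  using assms
proof (induction rule: cutfree.induct)
  case (Idt p)
  then show ?case by simp
next
  case (Ini D)
  then have l: "letters B \<subseteq> L" "letters C \<subseteq> L" by auto
  have "L \<turnstile> Ini D \<approx> L2 B C \<bullet> Ini C \<Colon> Zero \<rightarrow> B \<oplus> C"
    unfolding Ini(2) by (rule S_eq.sym[OF Ini_unique] l typing)+
  then show ?case using l by (blast intro: typing)
next
  case (K1 f A D A')
  then obtain f' where f': "L \<turnstile> f' \<Colon> A \<rightarrow> C" "L \<turnstile> f \<approx> L2 B C \<bullet> f' \<Colon> A \<rightarrow> B \<oplus> C"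
    using G_comp_K1[OF cutfree_type[OF K1(1)]] by blast
  have l: "letters A \<subseteq> L" "letters A' \<subseteq> L" "letters B \<subseteq> L" "letters C \<subseteq> L"
    using K1(2) S_eq_typed[OF f'(2)] by auto
  have "L \<turnstile> f \<bullet> K1 A A' \<approx> (L2 B C \<bullet> f') \<bullet> K1 A A' \<Colon> A \<otimes> A' \<rightarrow> B \<oplus> C" (is "S_eq _ _ ?t _ _")
    by (rule comp_cong_left f' l typing)+
  also have "L \<turnstile> ?t \<approx> L2 B C \<bullet> (f' \<bullet> K1 A A') \<Colon> A \<otimes> A' \<rightarrow> B \<oplus> C"
    by (rule assoc' f' l typing)+
  finally show ?case using f' l by (blast intro: typing)
next
  case (K2 f A D A')
  then obtain f' where f': "L \<turnstile> f' \<Colon> A \<rightarrow> C" "L \<turnstile> f \<approx> L2 B C \<bullet> f' \<Colon> A \<rightarrow> B \<oplus> C"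
    using G_comp_K2[OF cutfree_type[OF K2(1)]] by blast
  have l: "letters A \<subseteq> L" "letters A' \<subseteq> L" "letters B \<subseteq> L" "letters C \<subseteq> L"
    using K2(2) S_eq_typed[OF f'(2)] by auto
  have "L \<turnstile> f \<bullet> K2 A' A \<approx> (L2 B C \<bullet> f') \<bullet> K2 A' A \<Colon> A' \<otimes> A \<rightarrow> B \<oplus> C" (is "S_eq _ _ ?t _ _")
    by (rule comp_cong_left f' l typing)+
  also have "L \<turnstile> ?t \<approx> L2 B C \<bullet> (f' \<bullet> K2 A' A) \<Colon> A' \<otimes> A \<rightarrow> B \<oplus> C"
    by (rule assoc' f' l typing)+
  finally show ?case using f' l by (blast intro: typing)
next
  case (pair f A B' g C')
  then show ?case by simp
next
  case (L1 f A B' C')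
  then have f: "cutfree L f A B" and [simp]: "B' = B" "C' = C" by auto
  note l = L1(2) cutfree_letters[OF f]
  have "G f = {}"
    using L1(5) G_L1_comp[OF cutfree_type[OF f], of C] G_boundD(2)[OF cutfree_type[OF f]]
    by fastforce
  then obtain h where h: "L \<turnstile> h \<Colon> A \<rightarrow> Zero" "L \<turnstile> f \<approx> Ini B \<bullet> h \<Colon> A \<rightarrow> B"
    using empty_factors_Zero[OF f] by auto
  have l: "letters B \<subseteq> L" "letters C \<subseteq> L" using l by auto
  have "L \<turnstile> L1 B C \<bullet> f \<approx> L1 B C \<bullet> (Ini B \<bullet> h) \<Colon> A \<rightarrow> B \<oplus> C" (is "S_eq _ _ ?t _ _")
    by (rule comp_cong_right h l typing)+
  also have "L \<turnstile> ?t \<approx> Ini (B \<oplus> C) \<bullet> h \<Colon> A \<rightarrow> B \<oplus> C" (is "S_eq _ _ ?t _ _")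
    by (rule comp_Ini_comp h l typing)+
  also have "L \<turnstile> ?t \<approx> L2 B C \<bullet> (Ini C \<bullet> h) \<Colon> A \<rightarrow> B \<oplus> C"
    by (rule S_eq.sym[OF comp_Ini_comp] h l typing)+
  finally show ?case using h l by (auto intro!: exI[of _ "Ini C \<bullet> h"] typing)
next
  case (L2 f A C' B')
  then have f: "L \<turnstile> f \<Colon> A \<rightarrow> C" and [simp]: "B' = B" "C' = C"
    by (auto dest: cutfree_type)
  have "L \<turnstile> L2 B C \<bullet> f \<Colon> A \<rightarrow> B \<oplus> C"
    using L2 f by (auto intro!: typing dest: has_type_letters)
  then show ?case using f by (auto intro: S_eq.refl)
next
  case (copair f A D g A')
  note G = G_copair[OF cutfree_type[OF copair(1)] cutfree_type[OF copair(2)]]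
  obtain f' where f': "L \<turnstile> f' \<Colon> A \<rightarrow> C" "L \<turnstile> f \<approx> L2 B C \<bullet> f' \<Colon> A \<rightarrow> B \<oplus> C"
    using copair(3,5,6) G by blast
  obtain g' where g': "L \<turnstile> g' \<Colon> A' \<rightarrow> C" "L \<turnstile> g \<approx> L2 B C \<bullet> g' \<Colon> A' \<rightarrow> B \<oplus> C"
    using copair(4,5,6) G by blast
  have l: "letters B \<subseteq> L" "letters C \<subseteq> L" using S_eq_typed[OF f'(2)] by auto
  have "L \<turnstile> copair f g \<approx> copair (L2 B C \<bullet> f') (L2 B C \<bullet> g') \<Colon> A \<oplus> A' \<rightarrow> B \<oplus> C" (is "S_eq _ _ ?t _ _")
    by (rule copair_cong f' g')+
  also have "L \<turnstile> ?t \<approx> L2 B C \<bullet> copair f' g' \<Colon> A \<oplus> A' \<rightarrow> B \<oplus> C"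
    by (rule S_eq.sym[OF comp_copair] f' g' l typing)+
  finally show ?case using f' g' by (blast intro: typing)
next
  case (eq f A D g)
  then show ?case using G_sound[OF eq(2)] by (metis S_eq.sym S_eq.trans)
qed

section \<open>Inversion and the main induction\<close>

text \<open>The last structural rule may lie under any number of equality steps, so this is an
  induction and its conclusions hold only up to equality in S. The side conditions exclude
  \<open>Ini\<close>, copairing and pairing. The residual arrows are merely typed, which is enough
  because \<open>cut_elimination\<close> can be applied to them again.\<close>

lemma cutfree_inversion:
  assumes "cutfree L f A B" "A \<noteq> Zero" "\<nexists>A1 A2. A = A1 \<oplus> A2" "\<nexists>B1 B2. B = B1 \<otimes> B2"
  obtains
    (Idt) p where "A = Letter p" "B = Letter p" "L \<turnstile> f \<approx> Idt A \<Colon> A \<rightarrow> B"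
  | (K1) A1 A2 f' where "A = A1 \<otimes> A2" "L \<turnstile> f' \<Colon> A1 \<rightarrow> B" "L \<turnstile> f \<approx> f' \<bullet> K1 A1 A2 \<Colon> A \<rightarrow> B"
  | (K2) A1 A2 f' where "A = A1 \<otimes> A2" "L \<turnstile> f' \<Colon> A2 \<rightarrow> B" "L \<turnstile> f \<approx> f' \<bullet> K2 A1 A2 \<Colon> A \<rightarrow> B"
  | (L1) B1 B2 f' where "B = B1 \<oplus> B2" "L \<turnstile> f' \<Colon> A \<rightarrow> B1" "L \<turnstile> f \<approx> L1 B1 B2 \<bullet> f' \<Colon> A \<rightarrow> B"
  | (L2) B1 B2 f' where "B = B1 \<oplus> B2" "L \<turnstile> f' \<Colon> A \<rightarrow> B2" "L \<turnstile> f \<approx> L2 B1 B2 \<bullet> f' \<Colon> A \<rightarrow> B"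
  using assms
proof (induction arbitrary: thesis rule: cutfree.induct)
  case (Idt p)
  have "L \<turnstile> Idt (Letter p) \<approx> Idt (Letter p) \<Colon> Letter p \<rightarrow> Letter p"
    using Idt(1) by (intro S_eq.refl typing) simp
  then show ?case using Idt(2) by blast
next
  case (K1 f A C B)
  have "L \<turnstile> f \<bullet> K1 A B \<approx> f \<bullet> K1 A B \<Colon> A \<otimes> B \<rightarrow> C"
    by (rule S_eq.refl cutfree_type cutfree.K1 K1)+
  then show ?case using K1(5) cutfree_type[OF K1(1)] by blast
next
  case (K2 f B C A)
  have "L \<turnstile> f \<bullet> K2 A B \<approx> f \<bullet> K2 A B \<Colon> A \<otimes> B \<rightarrow> C"
    by (rule S_eq.refl cutfree_type cutfree.K2 K2)+
  then show ?case using K2(6) cutfree_type[OF K2(1)] by blast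
next
  case (L1 f A B C)
  have "L \<turnstile> L1 B C \<bullet> f \<approx> L1 B C \<bullet> f \<Colon> A \<rightarrow> B \<oplus> C"
    by (rule S_eq.refl cutfree_type cutfree.L1 L1)+
  then show ?case using L1(7) cutfree_type[OF L1(1)] by blast
next
  case (L2 f A C B)
  have "L \<turnstile> L2 B C \<bullet> f \<approx> L2 B C \<bullet> f \<Colon> A \<rightarrow> B \<oplus> C"
    by (rule S_eq.refl cutfree_type cutfree.L2 L2)+
  then show ?case using L2(8) cutfree_type[OF L2(1)] by blast
next
  case (eq f A B g)
  note e = S_eq.trans[OF S_eq.sym[OF eq(2)]]
  show ?case
    by (rule eq(3)) (use eq(4-) e in blast)+
qed auto

text \<open>The relation of f, and so that of g, lies over the first summand. Hence g factors
  through the same injection, even when its own cut-free form starts with a projection.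
  \<open>IH\<close> is the main induction at the smaller target.\<close>

lemma coherence_step_L1:
  assumes f: "L \<turnstile> f \<approx> L1 B1 B2 \<bullet> f' \<Colon> A \<rightarrow> B1 \<oplus> B2" "L \<turnstile> f' \<Colon> A \<rightarrow> B1"
    and g: "L \<turnstile> g \<Colon> A \<rightarrow> B1 \<oplus> B2" and G: "G f = G g"
    and IH: "\<And>g'. L \<turnstile> g' \<Colon> A \<rightarrow> B1 \<Longrightarrow> G f' = G g' \<Longrightarrow> L \<turnstile> f' \<approx> g' \<Colon> A \<rightarrow> B1"
  shows "L \<turnstile> f \<approx> g \<Colon> A \<rightarrow> B1 \<oplus> B2"
proof -
  have Gf: "G f = G f'" using G_sound[OF f(1)] G_L1_comp[OF f(2)] by simp
  then obtain g' where g': "L \<turnstile> g' \<Colon> A \<rightarrow> B1" "L \<turnstile> g \<approx> L1 B1 B2 \<bullet> g' \<Colon> A \<rightarrow> B1 \<oplus> B2"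
    using factors_L1[OF cut_elimination[OF g] HOL.refl] G G_boundD(2)[OF f(2)] by metis
  have l: "letters B1 \<subseteq> L" "letters B2 \<subseteq> L" using has_type_letters[OF g] by auto
  have "G g = G g'" using G_sound[OF g'(2)] G_L1_comp[OF g'(1)] by simp
  then have "L \<turnstile> f' \<approx> g' \<Colon> A \<rightarrow> B1" using IH g' G Gf by simp
  then have "L \<turnstile> L1 B1 B2 \<bullet> f' \<approx> L1 B1 B2 \<bullet> g' \<Colon> A \<rightarrow> B1 \<oplus> B2"
    by (rule comp_cong_right) (rule l typing)+
  then show ?thesis using f g' by (metis S_eq.sym S_eq.trans)
qed

lemma coherence_step_L2:
  assumes f: "L \<turnstile> f \<approx> L2 B1 B2 \<bullet> f' \<Colon> A \<rightarrow> B1 \<oplus> B2" "L \<turnstile> f' \<Colon> A \<rightarrow> B2"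
    and g: "L \<turnstile> g \<Colon> A \<rightarrow> B1 \<oplus> B2" and G: "G f = G g"
    and IH: "\<And>g'. L \<turnstile> g' \<Colon> A \<rightarrow> B2 \<Longrightarrow> G f' = G g' \<Longrightarrow> L \<turnstile> f' \<approx> g' \<Colon> A \<rightarrow> B2"
  shows "L \<turnstile> f \<approx> g \<Colon> A \<rightarrow> B1 \<oplus> B2"
proof -
  have Gf: "G f = {(x, y + occs B1) | x y. (x, y) \<in> G f'}"
    using G_sound[OF f(1)] G_L2_comp[OF f(2)] by simp
  then have "occs B1 \<le> y" if "(x, y) \<in> G g" for x y
    using G that by auto
  then obtain g' where g': "L \<turnstile> g' \<Colon> A \<rightarrow> B2" "L \<turnstile> g \<approx> L2 B1 B2 \<bullet> g' \<Colon> A \<rightarrow> B1 \<oplus> B2"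
    using factors_L2[OF cut_elimination[OF g] HOL.refl] by metis
  have l: "letters B1 \<subseteq> L" "letters B2 \<subseteq> L" using has_type_letters[OF g] by auto
  have "G g = {(x, y + occs B1) | x y. (x, y) \<in> G g'}"
    using G_sound[OF g'(2)] G_L2_comp[OF g'(1)] by simp
  with Gf G have "G f' = G g'" by - (rule shift_right_inject[of "occs B1"], simp)
  then have "L \<turnstile> f' \<approx> g' \<Colon> A \<rightarrow> B2" using IH g' by simp
  then have "L \<turnstile> L2 B1 B2 \<bullet> f' \<approx> L2 B1 B2 \<bullet> g' \<Colon> A \<rightarrow> B1 \<oplus> B2"
    by (rule comp_cong_right) (rule l typing)+
  then show ?thesis using f g' by (metis S_eq.sym S_eq.trans)
qed

theorem mainTheorem1:
  fixes L :: "'a set" and f g :: "'a tm" and A B :: "'a formula"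
  assumes "L \<turnstile> f \<Colon> A \<rightarrow> B" and "L \<turnstile> g \<Colon> A \<rightarrow> B"
    and "G f = G g"
  shows "L \<turnstile> f \<approx> g \<Colon> A \<rightarrow> B"
  using assms
proof (induction "size A + size B" arbitrary: A B f g rule: less_induct)
  case less
  note f = less(2) and g = less(3) and G = less(4)
  note l = has_type_letters[OF f]
  \<comment> \<open>In the last case the source is a letter or a product. The target is a letter or
    a sum, since a nonempty relation also rules out \<open>Zero\<close>.\<close>
  consider "G f = {}" | "A = Zero" | "B = Zero" | A1 A2 where "A = A1 \<oplus> A2" | B1 B2 where "B = B1 \<otimes> B2"
    | "G f \<noteq> {}" "A \<noteq> Zero" "\<nexists>A1 A2. A = A1 \<oplus> A2" "\<nexists>B1 B2. B = B1 \<otimes> B2"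
    by blast
  then show ?case
  proof cases
    case 1
    then show ?thesis using empty_coherence f g G by metis
  next
    case 2
    then show ?thesis using f g Ini_unique by (metis S_eq.sym S_eq.trans)
  next
    case 3
    then show ?thesis using f g Zero_subterminal by metis
  next
    case 4
    note f = f[unfolded 4] and g = g[unfolded 4]
    have l: "letters A1 \<subseteq> L" "letters A2 \<subseteq> L" using l 4 by auto
    show ?thesis unfolding 4
    proof (rule sum_ext[OF f g])
      \<comment> \<open>Equality of relations survives composition with a fixed arrow, so the
        components have equal relations without any computation.\<close>
      show "L \<turnstile> f \<bullet> L1 A1 A2 \<approx> g \<bullet> L1 A1 A2 \<Colon> A1 \<rightarrow> B"
        using G 4 by (intro less(1) has_type.Comp[OF _ f] has_type.Comp[OF _ g] has_type.L1 l) auto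
      show "L \<turnstile> f \<bullet> L2 A1 A2 \<approx> g \<bullet> L2 A1 A2 \<Colon> A2 \<rightarrow> B"
        using G 4 by (intro less(1) has_type.Comp[OF _ f] has_type.Comp[OF _ g] has_type.L2 l) auto
    qed
  next
    case 5
    note f = f[unfolded 5] and g = g[unfolded 5]
    have l: "letters B1 \<subseteq> L" "letters B2 \<subseteq> L" using l 5 by auto
    show ?thesis unfolding 5
    proof (rule prod_ext[OF f g])
      show "L \<turnstile> K1 B1 B2 \<bullet> f \<approx> K1 B1 B2 \<bullet> g \<Colon> A \<rightarrow> B1"
        using G 5 by (intro less(1) has_type.Comp[OF f] has_type.Comp[OF g] has_type.K1 l) auto
      show "L \<turnstile> K2 B1 B2 \<bullet> f \<approx> K2 B1 B2 \<bullet> g \<Colon> A \<rightarrow> B2"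
        using G 5 by (intro less(1) has_type.Comp[OF f] has_type.Comp[OF g] has_type.K2 l) auto
    qed
  next
    case 6
    \<comment> \<open>The two arrows are quantified afresh because the step is also applied with f
      and g exchanged, when it is g that ends with the injection.\<close>
    have stepL1: "L \<turnstile> f \<approx> g \<Colon> A \<rightarrow> B"
      if "B = B1 \<oplus> B2" "L \<turnstile> f \<approx> L1 B1 B2 \<bullet> f' \<Colon> A \<rightarrow> B" "L \<turnstile> f' \<Colon> A \<rightarrow> B1"
        "L \<turnstile> g \<Colon> A \<rightarrow> B" "G f = G g" for f g f' B1 B2
      using that less(1)[OF _ that(3)] by (auto intro!: coherence_step_L1[of L f B1 B2 f'])
    have stepL2: "L \<turnstile> f \<approx> g \<Colon> A \<rightarrow> B"
      if "B = B1 \<oplus> B2" "L \<turnstile> f \<approx> L2 B1 B2 \<bullet> f' \<Colon> A \<rightarrow> B" "L \<turnstile> f' \<Colon> A \<rightarrow> B2"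
        "L \<turnstile> g \<Colon> A \<rightarrow> B" "G f = G g" for f g f' B1 B2
      using that less(1)[OF _ that(3)] by (auto intro!: coherence_step_L2[of L f B1 B2 f'])
    \<comment> \<open>All pairs of the first arrow start below \<open>occs A1\<close> and all pairs
      of the second at or above it, so a common relation would be empty.\<close>
    have K12: False
      if "A = A1 \<otimes> A2" "L \<turnstile> f' \<Colon> A1 \<rightarrow> B" "L \<turnstile> f \<approx> f' \<bullet> K1 A1 A2 \<Colon> A \<rightarrow> B"
        "L \<turnstile> g' \<Colon> A2 \<rightarrow> B" "L \<turnstile> g \<approx> g' \<bullet> K2 A1 A2 \<Colon> A \<rightarrow> B" "G f = G g" "G f \<noteq> {}" for f g f' g' A1 A2
    proof -
      have "G f = G f'" using G_sound[OF that(3)] G_comp_K1[OF that(2)] by simp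
      moreover have "G f = {(x + occs A1, y) | x y. (x, y) \<in> G g'}"
        using G_sound[OF that(5)] G_comp_K2[OF that(4)] that(6) by simp
      ultimately show False using G_boundD(1)[OF that(2)] that(7) by fastforce
    qed
    show ?thesis
    proof (cases rule: cutfree_inversion[OF cut_elimination[OF f] 6(2-4), case_names Idt K1 K2 L1 L2])
      case fI: (Idt p)
      show ?thesis
      proof (cases rule: cutfree_inversion[OF cut_elimination[OF g] 6(2-4), case_names Idt K1 K2 L1 L2])
        case (Idt q)
        then show ?thesis using fI by (metis S_eq.sym S_eq.trans)
      qed (use fI in simp_all)
    next
      case fL1: (L1 B1 B2 f')
      then show ?thesis using stepL1 g G by blast
    next
      case fL2: (L2 B1 B2 f')
      then show ?thesis using stepL2 g G by blast
    next
      \<comment> \<open>An injection at the end of g is extracted from f by symmetry. Otherwise both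
        arrows start with projections of the same product, which must then be the same
        projection.\<close>
      case fK1: (K1 A1 A2 f')
      show ?thesis
      proof (cases rule: cutfree_inversion[OF cut_elimination[OF g] 6(2-4), case_names Idt K1 K2 L1 L2])
        case (Idt p)
        with fK1 show ?thesis by simp
      next
        case (L1 B1 B2 g')
        then show ?thesis using stepL1[OF _ _ _ f] G S_eq.sym by metis
      next
        case (L2 B1 B2 g')
        then show ?thesis using stepL2[OF _ _ _ f] G S_eq.sym by metis
      next
        case (K2 A1' A2' g')
        then show ?thesis using K12[of A1 A2 f' f g' g] fK1 G 6(1) by simp
      next
        case (K1 A1' A2' g')
        then have [simp]: "A1' = A1" "A2' = A2" using fK1 by auto
        note G' = G_sound[OF fK1(3)] G_comp_K1[OF fK1(2)] G_sound[OF K1(3)] G_comp_K1[OF K1(2)]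
        have "L \<turnstile> f' \<approx> g' \<Colon> A1 \<rightarrow> B"
          using fK1 K1 G' G by (intro less(1)) auto
        then have "L \<turnstile> f' \<bullet> K1 A1 A2 \<approx> g' \<bullet> K1 A1 A2 \<Colon> A \<rightarrow> B"
          unfolding fK1(1) using l fK1(1) by (auto intro!: comp_cong_left typing)
        note S_eq.trans[OF fK1(3) this]
        moreover have "L \<turnstile> g' \<bullet> K1 A1 A2 \<approx> g \<Colon> A \<rightarrow> B"
          using S_eq.sym[OF K1(3)] by simp
        ultimately show ?thesis by (rule S_eq.trans)
      qed
    next
      case fK2: (K2 A1 A2 f')
      show ?thesis
      proof (cases rule: cutfree_inversion[OF cut_elimination[OF g] 6(2-4), case_names Idt K1 K2 L1 L2])
        case (Idt p)
        with fK2 show ?thesis by simp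
      next
        case (L1 B1 B2 g')
        then show ?thesis using stepL1[OF _ _ _ f] G S_eq.sym by metis
      next
        case (L2 B1 B2 g')
        then show ?thesis using stepL2[OF _ _ _ f] G S_eq.sym by metis
      next
        case (K1 A1' A2' g')
        then show ?thesis using K12[of A1 A2 g' g f' f] fK2 G 6(1) by simp
      next
        case (K2 A1' A2' g')
        then have [simp]: "A1' = A1" "A2' = A2" using fK2 by auto
        note G' = G_sound[OF fK2(3)] G_comp_K2[OF fK2(2)] G_sound[OF K2(3)] G_comp_K2[OF K2(2)]
        \<comment> \<open>Both relations carry the same shift by \<open>occs A1\<close>; undoing it
          compares the residual arrows, whose source is only the second factor.\<close>
        then have "G f' = G g'" using G by - (rule shift_left_inject[of "occs A1"], simp del: G.simps)
        then have "L \<turnstile> f' \<approx> g' \<Colon> A2 \<rightarrow> B"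
          using fK2 K2 by (intro less(1)) auto
        then have "L \<turnstile> f' \<bullet> K2 A1 A2 \<approx> g' \<bullet> K2 A1 A2 \<Colon> A \<rightarrow> B"
          unfolding fK2(1) using l fK2(1) by (auto intro!: comp_cong_left typing)
        note S_eq.trans[OF fK2(3) this]
        moreover have "L \<turnstile> g' \<bullet> K2 A1 A2 \<approx> g \<Colon> A \<rightarrow> B"
          using S_eq.sym[OF K2(3)] by simp
        ultimately show ?thesis by (rule S_eq.trans)
      qed
    qed
  qed
qed

end
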